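(* Let $\mathbb{F}_q$ be a finite field with $q$ elements and $\operatorname{char}\mathbb{F}_q\neq 2$. For $j\in\{3,4,5,6,8,14,15,16,17,18,19\}$ let $\Phi_j$ be the set of valid pairs and $\Psi_j$ the set of smooth pairs in the pencil $\mathscr{P}_j$. Let $p^{\mathrm{sm}}_j$ (respectively $p^{\mathrm{val}}_j$) be the probability that a uniformly random element of $\Psi_j$ (respectively $\Phi_j$) is a $4$-Poncelet pair. Then: \begin{itemize} \item for $j\in\{3,16\}$: $p^{\mathrm{sm}}_j=\frac{3}{q-2}$ for $q>3$ (for $q=3$ the set $\Psi_j$ is empty), and $p^{\mathrm{val}}_j=\frac3q$; \item for $j\in\{4,15\}$: $p^{\mathrm{sm}}_j=\frac{1}{q-2}$ and $p^{\mathrm{val}}_j=\frac{1}{q-1}$; \item for $j\in\{5,8\}$: $p^{\mathrm{sm}}_j=p^{\mathrm{val}}_j=0$; \item for $j\in\{6,17\}$: $p^{\mathrm{sm}}_j=p^{\mathrm{val}}_j=\frac{1}{q-2}$; \item for $j\in\{14,19\}$: $p^{\mathrm{sm}}_j=p^{\mathrm{val}}_j=\frac1q$; \item for $j=18$: $p^{\mathrm{sm}}_j=p^{\mathrm{val}}_j=0$. \end{itemize}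
   Context: Conics. A conic in $\mathbf{P}^2(\mathbb{F}_q)$ is given by a nonzero quadratic form in $x,y,z$ over $\mathbb{F}_q$ (up to scalar), represented by its symmetric $3\times 3$ matrix; it is smooth if the matrix is invertible and singular otherwise. Singular conics are regarded over the algebraic closure $\overline{\mathbb{F}_q}$: each is either a double line or a union of two distinct lines defined over $\overline{\mathbb{F}_q}$ (a conic consisting of a single $\mathbb{F}_q$-point is the union of two conjugate lines). Pencils. The pencil $\mathscr{P}_j$ has two generators with matrices $A_j,B_j$; its elements are indexed by $\eta\in\mathbf{P}^1(\mathbb{F}_q)=\mathbb{F}_q\cup\{\infty\}$, the conic with parameter $\eta$ having matrix $C_j(\eta)=\eta A_j+B_j$, with $C_j(\infty)=A_j$. The generators (quadratic forms of $A_j$; of $B_j$) are: $\mathscr{P}_3$: $xy$; $xz+yz+z^2$. $\mathscr{P}_4$: $xy$; $xz+z^2$. $\mathscr{P}_5$: $xy$; $xz+y^2$. $\mathscr{P}_6$: $xy$; $z^2$. $\mathscr{P}_8$: $x^2$; $xy+z^2$. $\mathscr{P}_{14}$: $xy$; $xz+y^2+yz+ez^2$. $\mathscr{P}_{15}$: $xy$; $y^2+yz+ez^2$. $\mathscr{P}_{16}$: $xy$; $ex^2+xz+dy^2+yz+z^2$. $\mathscr{P}_{17}$: $x^2$; $y^2+yz+ez^2$. $\mathscr{P}_{18}$: $-xz+y^2$; $x^2+cxy+by^2+yz$. $\mathscr{P}_{19}$: $x^2-\nu y^2$; $2\sigma xy-\rho y^2+z^2$. Here $b,c,d,e,\nu,\rho,\sigma\in\mathbb{F}_q$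 are fixed so that $T^3+bT^2+cT+1$, $T^2+T+d$, $T^2+T+e$ are irreducible in $\mathbb{F}_q[T]$, and $\nu$ and $\rho^2-4\nu\sigma^2$ are non-squares in $\mathbb{F}_q$. Pairs. A pair $(\mathscr{A},\mathscr{B})$ of conics of $\mathscr{P}_j$ (an ordered pair, identified with its pair of parameters $(r,s)$) is valid if the two conics are distinct, $\mathscr{B}$ is smooth, and $\mathscr{A}$ is either smooth or the union of two distinct lines (over $\overline{\mathbb{F}_q}$) neither of which is tangent to $\mathscr{B}$. A smooth pair is an ordered pair of distinct smooth conics of the pencil. Poncelet pairs. $(\mathscr{A},\mathscr{B})$ is an $n$-Poncelet pair if, over $\overline{\mathbb{F}_q}$, there is an $n$-sided polygon inscribed in $\mathscr{A}$ and circumscribed about $\mathscr{B}$. For $n=4$ this is taken in the form of Cayley's criterion: if $A,B$ are the matrices of $\mathscr{A},\mathscr{B}$ and $\sqrt{\det(tA+B)}=H_0+H_1t+H_2t^2+H_3t^3+\cdots$ is the formal power series expansion over $\overline{\mathbb{F}_q}$ (either choice of square root), then $(\mathscr{A},\mathscr{B})$ is a $4$-Poncelet pair if and only if $H_3=0$. *)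

theory Defs
  imports
    "HOL-Algebra.Algebraic_Closure_Type"
    "HOL-Computational_Algebra.Computational_Algebra"
    "HOL-Probability.Probability"
begin

definition qform_matrix :: "'a::field \<Rightarrow> 'a \<Rightarrow> 'a \<Rightarrow> 'a \<Rightarrow> 'a \<Rightarrow> 'a \<Rightarrow> 'a^3^3" where
  "qform_matrix xx yy zz xy xz yz = vector
    [vector [xx, xy / 2, xz / 2],
     vector [xy / 2, yy, yz / 2],
     vector [xz / 2, yz / 2, zz]]"

definition qform :: "'a::comm_ring_1^3^3 \<Rightarrow> 'a^3 \<Rightarrow> 'a" where
  "qform M v = scalar_product v (M *v v)"

lemma qform_qform_matrix:
  fixes xx yy zz xy xz yz x y z :: "'a::field"
  assumes "(2::'a) \<noteq> 0"
  shows "qform (qform_matrix xx yy zz xy xz yz) (vector [x, y, z])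
       = xx * x\<^sup>2 + yy * y\<^sup>2 + zz * z\<^sup>2 + xy * (x * y) + xz * (x * z) + yz * (y * z)"
proof -
  have half: "a / 2 + a / 2 = a" for a :: 'a
    using assms by (metis add_divide_distrib mult_2 nonzero_mult_div_cancel_left)
  have "qform (qform_matrix xx yy zz xy xz yz) (vector [x, y, z])
      = xx * x\<^sup>2 + yy * y\<^sup>2 + zz * z\<^sup>2 + (xy / 2 + xy / 2) * (x * y)
        + (xz / 2 + xz / 2) * (x * z) + (yz / 2 + yz / 2) * (y * z)"
    unfolding qform_def qform_matrix_def scalar_product_def matrix_vector_mult_def
    by (simp add: sum_3 vector_3 power2_eq_square ring_distribs mult_ac add_ac)
  then show ?thesis by (simp only: half)
qed


text \<open>
  A conic over the field \<open>'a\<close> is represented by its symmetric matrix, determined up to a nonzero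
  scalar. Over the algebraic closure, subsets of the projective plane are represented by the
  corresponding cones in affine 3-space, which contain the zero vector.
\<close>

definition same_conic :: "'a::field^3^3 \<Rightarrow> 'a^3^3 \<Rightarrow> bool" where
  "same_conic A B \<longleftrightarrow> (\<exists>k. k \<noteq> 0 \<and> A = map_matrix ((*) k) B)"

definition smooth_conic :: "'a::field^3^3 \<Rightarrow> bool" where
  "smooth_conic A \<longleftrightarrow> invertible A"

definition conic_points :: "'a::field^3^3 \<Rightarrow> ('a alg_closure^3) set" where
  "conic_points A = {v. qform (map_matrix to_ac A) v = 0}"

definition line_of :: "'a::field alg_closure^3 \<Rightarrow> ('a alg_closure^3) set" where
  "line_of l = {v. scalar_product l v = 0}"

definition is_line :: "('a::field alg_closure^3) set \<Rightarrow> bool" where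
  "is_line L \<longleftrightarrow> (\<exists>l. l \<noteq> 0 \<and> L = line_of l)"

text \<open>
  The tangent line to the conic with matrix \<open>B\<close> at its point \<open>p\<close> has coefficient vector \<open>B p\<close>
  (half the gradient of the quadratic form), which is nonzero when \<open>B\<close> is smooth.
\<close>

definition tangent_to :: "('a::field alg_closure^3) set \<Rightarrow> 'a^3^3 \<Rightarrow> bool" where
  "tangent_to L B \<longleftrightarrow>
     (\<exists>p. p \<noteq> 0 \<and> p \<in> conic_points B \<and> L = line_of (map_matrix to_ac B *v p))"


text \<open>
  A pencil is given by its two generators. A parameter in the projective line over \<open>'a\<close> is an
  element of \<open>'a option\<close>, with \<open>None\<close> as the point at infinity.
\<close>

type_synonym 'a pencil = "('a^3^3) \<times> ('a^3^3)"

fun pencil_conic :: "'a::field pencil \<Rightarrow> 'a option \<Rightarrow> 'a^3^3" where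
  "pencil_conic (A, B) None = A"
| "pencil_conic (A, B) (Some \<eta>) = map_matrix ((*) \<eta>) A + B"

text \<open>The coefficients are those of \<open>x\<^sup>2\<close>, \<open>y\<^sup>2\<close>, \<open>z\<^sup>2\<close>, \<open>xy\<close>, \<open>xz\<close>, \<open>yz\<close>, in this order.\<close>

definition pencil3 :: "'a::field pencil" where
  "pencil3 = (qform_matrix 0 0 0 1 0 0, qform_matrix 0 0 1 0 1 1)"

definition pencil4 :: "'a::field pencil" where
  "pencil4 = (qform_matrix 0 0 0 1 0 0, qform_matrix 0 0 1 0 1 0)"

definition pencil5 :: "'a::field pencil" where
  "pencil5 = (qform_matrix 0 0 0 1 0 0, qform_matrix 0 1 0 0 1 0)"

definition pencil6 :: "'a::field pencil" where
  "pencil6 = (qform_matrix 0 0 0 1 0 0, qform_matrix 0 0 1 0 0 0)"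

definition pencil8 :: "'a::field pencil" where
  "pencil8 = (qform_matrix 1 0 0 0 0 0, qform_matrix 0 0 1 1 0 0)"

definition pencil14 :: "'a::field \<Rightarrow> 'a pencil" where
  "pencil14 e = (qform_matrix 0 0 0 1 0 0, qform_matrix 0 1 e 0 1 1)"

definition pencil15 :: "'a::field \<Rightarrow> 'a pencil" where
  "pencil15 e = (qform_matrix 0 0 0 1 0 0, qform_matrix 0 1 e 0 0 1)"

definition pencil16 :: "'a::field \<Rightarrow> 'a \<Rightarrow> 'a pencil" where
  "pencil16 d e = (qform_matrix 0 0 0 1 0 0, qform_matrix e d 1 0 1 1)"

definition pencil17 :: "'a::field \<Rightarrow> 'a pencil" where
  "pencil17 e = (qform_matrix 1 0 0 0 0 0, qform_matrix 0 1 e 0 0 1)"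

definition pencil18 :: "'a::field \<Rightarrow> 'a \<Rightarrow> 'a pencil" where
  "pencil18 b c = (qform_matrix 0 1 0 0 (-1) 0, qform_matrix 1 b 0 c 0 1)"

definition pencil19 :: "'a::field \<Rightarrow> 'a \<Rightarrow> 'a \<Rightarrow> 'a pencil" where
  "pencil19 \<nu> \<rho> \<sigma> = (qform_matrix 1 (-\<nu>) 0 0 0 0, qform_matrix 0 (-\<rho>) 1 (2 * \<sigma>) 0 0)"


definition valid_pair :: "'a::field^3^3 \<Rightarrow> 'a^3^3 \<Rightarrow> bool" where
  "valid_pair A B \<longleftrightarrow> \<not> same_conic A B \<and> smooth_conic B \<and>
     (smooth_conic A \<or>
      (\<exists>L M. is_line L \<and> is_line M \<and> L \<noteq> M \<and> conic_points A = L \<union> M \<and>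
             \<not> tangent_to L B \<and> \<not> tangent_to M B))"

definition smooth_pair :: "'a::field^3^3 \<Rightarrow> 'a^3^3 \<Rightarrow> bool" where
  "smooth_pair A B \<longleftrightarrow> \<not> same_conic A B \<and> smooth_conic A \<and> smooth_conic B"

definition valid_pairs :: "'a::field pencil \<Rightarrow> ('a option \<times> 'a option) set" where
  "valid_pairs P = {(r, s). valid_pair (pencil_conic P r) (pencil_conic P s)}"

definition smooth_pairs :: "'a::field pencil \<Rightarrow> ('a option \<times> 'a option) set" where
  "smooth_pairs P = {(r, s). smooth_pair (pencil_conic P r) (pencil_conic P s)}"

text \<open>
  Cayley's criterion for \<open>n = 4\<close>. If \<open>B\<close> is smooth, the square root \<open>H\<close> exists over the algebraic
  closure (in characteristic other than 2) and is unique up to sign, so the existential quantifier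
  ranges over the two choices, for which \<open>H\<^sub>3\<close> agrees up to sign.
\<close>

definition poncelet4 :: "'a::field^3^3 \<Rightarrow> 'a^3^3 \<Rightarrow> bool" where
  "poncelet4 A B \<longleftrightarrow>
     (\<exists>H :: 'a alg_closure fps.
        H\<^sup>2 = det (\<chi> i j. fps_X * fps_const (to_ac (A $ i $ j)) + fps_const (to_ac (B $ i $ j)))
        \<and> fps_nth H 3 = 0)"

text \<open>
  The set \<open>S\<close> is required to be nonempty because \<open>pmf_of_set {}\<close> is unspecified.
\<close>

definition poncelet4_prob_is ::
    "'a::{field,finite} pencil \<Rightarrow> ('a option \<times> 'a option) set \<Rightarrow> real \<Rightarrow> bool" where
  "poncelet4_prob_is P S p \<longleftrightarrow> S \<noteq> {} \<and>
     measure_pmf.prob (pmf_of_set S)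
       {(r, s). poncelet4 (pencil_conic P r) (pencil_conic P s)} = p"

end

theory Submission
  imports Defs
begin

text \<open>
  The pencil generated by \<open>G\<close> and \<open>H\<close> has a discriminant, the binary cubic form
  \<open>D(\<lambda>, \<mu>) = det (\<lambda> G + \<mu> H)\<close>, whose zeros are the parameters of the singular conics. Write
  \<open>C\<^sub>r\<close> for the conic with homogeneous parameter \<open>r\<close>. Then \<open>det (t C\<^sub>r + C\<^sub>s) = D(t r + s)\<close>, so
  whether \<open>(C\<^sub>r, C\<^sub>s)\<close> is a Poncelet pair depends on \<open>D\<close>, \<open>r\<close> and \<open>s\<close> only. Over the algebraic
  closure write \<open>D(t r + s) = D(s) (1 + x\<^sub>1 t) (1 + x\<^sub>2 t) (1 + x\<^sub>3 t)\<close>. Eliminating the coefficients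
  of the square root from Cayley's condition \<open>H\<^sub>3 = 0\<close> gives
  \<open>(x\<^sub>1 + x\<^sub>2 - x\<^sub>3) (x\<^sub>1 - x\<^sub>2 + x\<^sub>3) (- x\<^sub>1 + x\<^sub>2 + x\<^sub>3) = 0\<close>, which is a polynomial relation between the
  coefficients of \<open>D(t r + s)\<close> (\<open>poncelet4_iff\<close>).

  For ten of the eleven pencils \<open>G\<close> is singular, so \<open>D = \<kappa> \<mu> Q(\<lambda>, \<mu>)\<close> with a quadratic form \<open>Q\<close>, and the
  relation splits over the ground field: either \<open>x\<^sub>2 + x\<^sub>3 = x\<^sub>1\<close> for the two factors belonging to
  \<open>Q\<close>, which is linear in \<open>r\<close>, or \<open>x\<^sub>1\<^sup>2 = (x\<^sub>2 - x\<^sub>3)\<^sup>2\<close>, where the right-hand side is the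
  discriminant of \<open>Q\<close> times a square (\<open>poncelet4_pencil_rational_singular\<close>). Everything now depends on the
  discriminant of \<open>Q\<close>. If it is a nonsquare, only the linear condition can hold, and every smooth
  \<open>C\<^sub>s\<close> has exactly one partner \<open>C\<^sub>r\<close>. If it is a nonzero square and \<open>\<mu>\<close> does not divide \<open>Q\<close>, there
  are three linear conditions and three partners. The degenerate forms \<open>\<lambda>\<^sup>2\<close>, \<open>\<lambda>\<mu>\<close>
  and \<open>\<mu>\<^sup>2\<close> are done directly. In the remaining pencil \<open>D\<close> is irreducible, and the relation would give the
  rational root \<open>t = - 2 / (x\<^sub>1 + x\<^sub>2 + x\<^sub>3)\<close> of \<open>D(t r + s)\<close> (the point at infinity if the sum
  is zero), so there are no Poncelet pairs.

  In each case the number of partners \<open>r\<close> is the same for all smooth \<open>C\<^sub>s\<close>, which gives the probability as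
  soon as the partners are admissible (\<open>poncelet4_prob_is_uniform\<close>). In the cases with three partners and
  with irreducible \<open>Q\<close>, some partners are singular. They count for valid pairs, but must be discarded for smooth
  pairs, and each singular conic turns out to be the partner of exactly one smooth conic
  (\<open>poncelet4_prob_is_smooth\<close>).

  It remains to decide which singular conics occur in valid pairs. A line \<open>l\<close> is tangent to a smooth conic
  \<open>B\<close> exactly when it lies on the dual conic, \<open>l\<^sup>T adj(B) l = 0\<close> (\<open>tangent_to_iff\<close>). Since the two lines of a
  singular conic are determined by its point set, validity becomes a computation with explicit factors of
  the quadratic form.
\<close>

no_notation fps_nth (infixl \<open>$\<close> 75)

section \<open>Cayley's condition in terms of determinant coefficients\<close>

text \<open>
  The coefficient of degree \<open>n > 0\<close> in \<open>H\<^sup>2 = F\<close> is linear in \<open>H\<^sub>n\<close> with factor \<open>2 H\<^sub>0\<close>, so the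
  coefficients of a square root with prescribed \<open>H\<^sub>0 = h\<close> can be computed recursively.
\<close>

fun sqrt_coeff :: "'a::field \<Rightarrow> (nat \<Rightarrow> 'a) \<Rightarrow> nat \<Rightarrow> 'a" where
  "sqrt_coeff h f n =
     (if n = 0 then h
      else (f n - (\<Sum>i\<in>{1..<n}. sqrt_coeff h f i * sqrt_coeff h f (n - i))) / (2 * h))"
declare sqrt_coeff.simps [simp del]

lemma fps_sqrt_exists:
  fixes F :: "'a::field fps"
  assumes "(2::'a) \<noteq> 0" "h \<noteq> 0" "h\<^sup>2 = fps_nth F 0"
  shows "\<exists>H. H\<^sup>2 = F"
proof -
  define c where "c = sqrt_coeff h (fps_nth F)"
  have c0: "c 0 = h" by (simp add: c_def sqrt_coeff.simps)
  have "fps_nth ((Abs_fps c)\<^sup>2) n = fps_nth F n" for n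
  proof (cases "n = 0")
    case True
    then show ?thesis using assms(3) c0 by (simp add: fps_square_nth fps_mult_nth power2_eq_square)
  next
    case False
    have cn: "2 * h * c n = fps_nth F n - (\<Sum>i\<in>{1..<n}. c i * c (n - i))"
      unfolding c_def by (subst sqrt_coeff.simps) (use False assms in simp)
    have "{0..n} = insert 0 (insert n {1..<n})" using False by auto
    then have "(\<Sum>i=0..n. c i * c (n - i)) = 2 * h * c n + (\<Sum>i\<in>{1..<n}. c i * c (n - i))"
      using False c0 by (simp add: algebra_simps)
    then show ?thesis using cn by (simp add: power2_eq_square fps_mult_nth)
  qed
  then show ?thesis by (metis fps_eq_iff)
qed

text \<open>
  Comparing coefficients in \<open>H\<^sup>2 = d\<^sub>0 + d\<^sub>1 t + d\<^sub>2 t\<^sup>2 + d\<^sub>3 t\<^sup>3\<close> and eliminating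
  \<open>H\<^sub>1\<close> and \<open>H\<^sub>2\<close> gives \<open>d\<^sub>1\<^sup>3 - 4 d\<^sub>0 d\<^sub>1 d\<^sub>2 + 8 d\<^sub>0\<^sup>2 d\<^sub>3 = 16 H\<^sub>0\<^sup>5 H\<^sub>3\<close>, so
  Cayley's condition can be tested in the ground field, without a square root.
\<close>

lemma poncelet4_iff:
  fixes A B :: "'a::field^3^3" and d0 d1 d2 d3 :: 'a
  assumes two: "(2::'a) \<noteq> 0" and d0: "d0 \<noteq> 0"
    and det: "det (\<chi> i j. fps_X * fps_const (to_ac (A $ i $ j)) + fps_const (to_ac (B $ i $ j)))
            = fps_const (to_ac d0) + fps_const (to_ac d1) * fps_X
              + fps_const (to_ac d2) * fps_X ^ 2 + fps_const (to_ac d3) * fps_X ^ 3"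
  shows "poncelet4 A B \<longleftrightarrow> d1 ^ 3 - 4 * d0 * d1 * d2 + 8 * d0\<^sup>2 * d3 = 0"
proof -
  define F where "F = fps_const (to_ac d0) + fps_const (to_ac d1) * fps_X
              + fps_const (to_ac d2) * fps_X ^ 2 + fps_const (to_ac d3) * fps_X ^ 3"
  have F: "fps_nth F 0 = to_ac d0" "fps_nth F 1 = to_ac d1" "fps_nth F 2 = to_ac d2"
    "fps_nth F 3 = to_ac d3"
    by (simp_all add: F_def fps_X_power_nth)
  have two': "(2::'a alg_closure) \<noteq> 0"
    using two by (metis to_ac_eq_0_iff to_ac_numeral)
  have key: "fps_nth H 3 = 0 \<longleftrightarrow> d1 ^ 3 - 4 * d0 * d1 * d2 + 8 * d0\<^sup>2 * d3 = 0"
    if H: "H\<^sup>2 = F" for H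
  proof -
    define h where "h = fps_nth H"
    have *: "(\<Sum>i=0..n. h i * h (n - i)) = fps_nth F n" for n
      unfolding H[symmetric] by (simp add: power2_eq_square fps_mult_nth h_def)
    have 0: "to_ac d0 = h 0 * h 0" using *[of 0] F by simp
    have 1: "to_ac d1 = 2 * h 0 * h 1" using *[of 1] F by (simp add: algebra_simps)
    have 2: "to_ac d2 = 2 * h 0 * h 2 + h 1 * h 1"
      using *[of 2] F by (simp add: numeral_2_eq_2 algebra_simps)
    have 3: "to_ac d3 = 2 * h 0 * h 3 + 2 * h 1 * h 2"
      using *[of 3] F by (simp add: numeral_3_eq_3 numeral_2_eq_2 algebra_simps)
    have "to_ac (d1 ^ 3 - 4 * d0 * d1 * d2 + 8 * d0\<^sup>2 * d3) = 16 * h 0 ^ 5 * h 3"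
      unfolding to_ac_add to_ac_diff to_ac_mult to_ac_power to_ac_numeral 0 1 2 3
      by (simp add: algebra_simps eval_nat_numeral)
    moreover have "h 0 \<noteq> 0" using 0 d0 by auto
    moreover have "(16::'a alg_closure) \<noteq> 0"
    proof -
      have "(16::'a alg_closure) = 2 ^ 4" by simp
      then show ?thesis using two' by (metis power_not_zero)
    qed
    ultimately show ?thesis unfolding h_def
      by (metis mult_eq_0_iff power_not_zero to_ac_eq_0_iff)
  qed
  obtain h where "h\<^sup>2 = to_ac d0" using nth_root_exists[of 2 "to_ac d0"] by auto
  moreover from this have "h \<noteq> 0" using d0 by auto
  ultimately obtain H where "H\<^sup>2 = F" using fps_sqrt_exists[OF two', of h F] F by auto
  then show ?thesis unfolding poncelet4_def det F_def[symmetric] using key by blast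
qed

section \<open>The discriminant of a pencil\<close>

text \<open>
  The polarization of the determinant: the coefficient of \<open>t\<close> in \<open>det (t A + B)\<close>, which is the trace of
  \<open>A adj(B)\<close>.
\<close>

definition mixed_det :: "'a::comm_ring_1^3^3 \<Rightarrow> 'a^3^3 \<Rightarrow> 'a" where
  "mixed_det A B =
      A$1$1 * (B$2$2 * B$3$3 - B$2$3 * B$3$2) - A$1$2 * (B$2$1 * B$3$3 - B$2$3 * B$3$1)
    + A$1$3 * (B$2$1 * B$3$2 - B$2$2 * B$3$1) - A$2$1 * (B$1$2 * B$3$3 - B$1$3 * B$3$2)
    + A$2$2 * (B$1$1 * B$3$3 - B$1$3 * B$3$1) - A$2$3 * (B$1$1 * B$3$2 - B$1$2 * B$3$1)
    + A$3$1 * (B$1$2 * B$2$3 - B$1$3 * B$2$2) - A$3$2 * (B$1$1 * B$2$3 - B$1$3 * B$2$1)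
    + A$3$3 * (B$1$1 * B$2$2 - B$1$2 * B$2$1)"

lemma det_linear_combination:
  fixes G H :: "'a::comm_ring_1^3^3"
  shows "det (\<chi> i j. u * G $ i $ j + v * H $ i $ j)
    = det G * u ^ 3 + mixed_det H G * u\<^sup>2 * v + mixed_det G H * u * v\<^sup>2 + det H * v ^ 3"
  unfolding det_3 mixed_det_def by (simp add: algebra_simps eval_nat_numeral)

text \<open>
  Homogeneous coordinates \<open>(pnum r : pden r)\<close> of a parameter. With them the conic at infinity needs no
  separate treatment.
\<close>

definition pnum :: "'a::field option \<Rightarrow> 'a" where
  "pnum r = (case r of None \<Rightarrow> 1 | Some x \<Rightarrow> x)"
definition pden :: "'a::field option \<Rightarrow> 'a" where
  "pden r = (case r of None \<Rightarrow> 0 | Some x \<Rightarrow> 1)"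

lemma pnum_simps [simp]: "pnum None = 1" "pnum (Some x) = x"
  and pden_simps [simp]: "pden None = 0" "pden (Some x) = 1"
  by (simp_all add: pnum_def pden_def)

lemma param_eqI:
  assumes "pnum s = k * pnum r" "pden s = k * pden r"
  shows "r = s"
  using assms by (cases r; cases s) auto

lemma pencil_conic_nth:
  "pencil_conic (G, H) r $ i $ j = pnum r * G $ i $ j + pden r * H $ i $ j"
  by (cases r) simp_all

definition disc_form :: "'a::comm_ring_1 \<Rightarrow> 'a \<Rightarrow> 'a \<Rightarrow> 'a \<Rightarrow> 'a \<Rightarrow> 'a \<Rightarrow> 'a" where
  "disc_form k0 k1 k2 k3 u v = k0 * u ^ 3 + k1 * u\<^sup>2 * v + k2 * u * v\<^sup>2 + k3 * v ^ 3"

text \<open>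
  The form \<open>D(\<lambda>, \<mu>) = det (\<lambda> G + \<mu> H)\<close> is recorded by its coefficients and not by its values, because it is
  going to be evaluated at power series.
\<close>

definition has_disc :: "'a::field pencil \<Rightarrow> 'a \<Rightarrow> 'a \<Rightarrow> 'a \<Rightarrow> 'a \<Rightarrow> bool" where
  "has_disc P k0 k1 k2 k3 \<longleftrightarrow> det (fst P) = k0 \<and> mixed_det (snd P) (fst P) = k1 \<and>
     mixed_det (fst P) (snd P) = k2 \<and> det (snd P) = k3"

lemma det_pencil_conic:
  assumes "has_disc P k0 k1 k2 k3"
  shows "det (pencil_conic P r) = disc_form k0 k1 k2 k3 (pnum r) (pden r)"
proof -
  obtain G H where P: "P = (G, H)" by (cases P)
  have "pencil_conic P r = (\<chi> i j. pnum r * G $ i $ j + pden r * H $ i $ j)"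
    by (simp add: P vec_eq_iff pencil_conic_nth)
  then show ?thesis
    using det_linear_combination[of "pnum r" G "pden r" H] assms
    by (simp add: has_disc_def P disc_form_def)
qed

lemma smooth_pencil_conic:
  assumes "has_disc P k0 k1 k2 k3"
  shows "smooth_conic (pencil_conic P r) \<longleftrightarrow> disc_form k0 k1 k2 k3 (pnum r) (pden r) \<noteq> 0"
  by (simp add: smooth_conic_def invertible_det_nz det_pencil_conic[OF assms])

text \<open>
  The discriminant form evaluated at \<open>t (a, b) + (c, d)\<close> is \<open>det (t C\<^sub>r + C\<^sub>s)\<close>; the numbers \<open>d\<^sub>i\<close>
  are its coefficients. The variables \<open>a, b, c, d\<close> and \<open>d\<^sub>i\<close> are kept separate from the terms that they stand
  for so that later applications can supply simplified expressions.
\<close>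

lemma poncelet4_pencil:
  fixes P :: "'a::field pencil"
  assumes two: "(2::'a) \<noteq> 0" and disc: "has_disc P k0 k1 k2 k3"
    and smooth: "disc_form k0 k1 k2 k3 (pnum s) (pden s) \<noteq> 0"
    and r: "pnum r = a" "pden r = b" and s: "pnum s = c" "pden s = d"
    and d0: "d0 = k0 * c^3 + k1 * c^2 * d + k2 * c * d^2 + k3 * d^3"
    and d1: "d1 = 3 * k0 * a * c^2 + k1 * (2*a*c*d + b*c^2) + k2 * (a*d^2 + 2*b*c*d) + 3*k3*b*d^2"
    and d2: "d2 = 3 * k0 * a^2 * c + k1 * (a^2*d + 2*a*b*c) + k2 * (2*a*b*d + b^2*c) + 3*k3*b^2*d"
    and d3: "d3 = k0 * a^3 + k1 * a^2 * b + k2 * a * b^2 + k3 * b^3"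
  shows "poncelet4 (pencil_conic P r) (pencil_conic P s) \<longleftrightarrow>
    d1 ^ 3 - 4 * d0 * d1 * d2 + 8 * d0\<^sup>2 * d3 = 0"
proof (rule poncelet4_iff[OF two])
  show "d0 \<noteq> 0" using smooth by (simp add: d0 disc_form_def s)
  obtain G H where P: "P = (G, H)" by (cases P)
  define c' :: "'a \<Rightarrow> 'a alg_closure fps" where "c' x = fps_const (to_ac x)" for x
  have hom: "c' (x + y) = c' x + c' y" "c' (x - y) = c' x - c' y" "c' (x * y) = c' x * c' y"
    "c' (x ^ n) = c' x ^ n" "c' (numeral k) = numeral k" for x y n k
    by (simp_all add: c'_def flip: fps_const_mult fps_const_add fps_const_sub fps_const_power
        numeral_fps_const)
  define U V where "U = c' a * fps_X + c' c" and "V = c' b * fps_X + c' d"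
  define G' H' :: "'a alg_closure fps^3^3"
    where "G' = (\<chi> i j. c' (G $ i $ j))" and "H' = (\<chi> i j. c' (H $ i $ j))"
  have detGH: "det G' = c' (det G)" "det H' = c' (det H)"
     "mixed_det H' G' = c' (mixed_det H G)" "mixed_det G' H' = c' (mixed_det G H)"
    by (simp_all add: G'_def H'_def det_3 mixed_det_def hom)
  have "(\<chi> i j. fps_X * c' (pencil_conic P r $ i $ j) + c' (pencil_conic P s $ i $ j))
     = (\<chi> i j. U * G' $ i $ j + V * H' $ i $ j)"
    by (simp add: vec_eq_iff P pencil_conic_nth hom U_def V_def G'_def H'_def r s algebra_simps)
  then have "det (\<chi> i j. fps_X * c' (pencil_conic P r $ i $ j) + c' (pencil_conic P s $ i $ j))
     = c' k0 * U ^ 3 + c' k1 * U\<^sup>2 * V + c' k2 * U * V\<^sup>2 + c' k3 * V ^ 3"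
    using disc by (simp add: det_linear_combination detGH has_disc_def P)
  also have "\<dots> = c' d0 + c' d1 * fps_X + c' d2 * fps_X ^ 2 + c' d3 * fps_X ^ 3"
    by (simp add: d0 d1 d2 d3 hom U_def V_def algebra_simps eval_nat_numeral)
  finally show "det (\<chi> i j. fps_X * fps_const (to_ac (pencil_conic P r $ i $ j))
       + fps_const (to_ac (pencil_conic P s $ i $ j)))
     = fps_const (to_ac d0) + fps_const (to_ac d1) * fps_X + fps_const (to_ac d2) * fps_X ^ 2
       + fps_const (to_ac d3) * fps_X ^ 3"
    by (simp add: c'_def)
qed

text \<open>
  Here \<open>det (t C\<^sub>r + C\<^sub>s) = \<kappa> (1 + b t) (Q + N t + Q(a, b) t\<^sup>2)\<close>, where \<open>N\<close> is the polar form of the quadratic form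
  at \<open>(a, b)\<close> and \<open>(x, 1)\<close>. So \<open>x\<^sub>1 = b\<close>, \<open>x\<^sub>2 + x\<^sub>3 = N / Q\<close>, and
  \<open>N\<^sup>2 - 4 Q Q(a, b)\<close>, the numerator of \<open>(x\<^sub>2 - x\<^sub>3)\<^sup>2\<close>, equals the discriminant of the quadratic form times
  \<open>(a - b x)\<^sup>2\<close>. The disjuncts say \<open>x\<^sub>2 + x\<^sub>3 = x\<^sub>1\<close> and \<open>x\<^sub>1\<^sup>2 = (x\<^sub>2 - x\<^sub>3)\<^sup>2\<close>.
\<close>

lemma poncelet4_pencil_rational_singular:
  fixes P :: "'a::field pencil"
  assumes two: "(2::'a) \<noteq> 0" and disc: "has_disc P 0 (\<kappa> * \<alpha>) (\<kappa> * \<beta>) (\<kappa> * \<gamma>)"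
    and k: "\<kappa> \<noteq> 0" and Q: "Q = \<alpha> * x\<^sup>2 + \<beta> * x + \<gamma>" "Q \<noteq> 0"
    and r: "pnum r = a" "pden r = b"
  shows "poncelet4 (pencil_conic P r) (pencil_conic P (Some x)) \<longleftrightarrow>
     2 * \<alpha> * a * x + \<beta> * (a + b * x) + 2 * \<gamma> * b = b * Q \<or>
     (b * Q)\<^sup>2 = (\<beta>\<^sup>2 - 4 * \<alpha> * \<gamma>) * (a - b * x)\<^sup>2"
    (is "_ \<longleftrightarrow> ?P = _ \<or> ?L = ?R")
proof -
  define d0 where "d0 = \<kappa> * Q"
  define d1 where "d1 = \<kappa> * (?P + b * Q)"
  define d2 where "d2 = \<kappa> * ((\<alpha> * a\<^sup>2 + \<beta> * a * b + \<gamma> * b\<^sup>2) + b * ?P)"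
  define d3 where "d3 = \<kappa> * b * (\<alpha> * a\<^sup>2 + \<beta> * a * b + \<gamma> * b\<^sup>2)"
  have "poncelet4 (pencil_conic P r) (pencil_conic P (Some x)) \<longleftrightarrow>
      d1 ^ 3 - 4 * d0 * d1 * d2 + 8 * d0\<^sup>2 * d3 = 0"
  proof (rule poncelet4_pencil[OF two disc _ r, where c = x and d = 1])
    have "disc_form 0 (\<kappa> * \<alpha>) (\<kappa> * \<beta>) (\<kappa> * \<gamma>) (pnum (Some x)) (pden (Some x)) = \<kappa> * Q"
      by (simp add: disc_form_def Q(1) algebra_simps)
    then show "disc_form 0 (\<kappa> * \<alpha>) (\<kappa> * \<beta>) (\<kappa> * \<gamma>) (pnum (Some x)) (pden (Some x)) \<noteq> 0"
      using k Q(2) by simp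
  qed (simp_all add: d0_def d1_def d2_def d3_def Q(1) algebra_simps eval_nat_numeral)
  also have "d1 ^ 3 - 4 * d0 * d1 * d2 + 8 * d0\<^sup>2 * d3 = - (\<kappa> ^ 3) * ((?P - b * Q) * (?L - ?R))"
  proof -
    have id: "(k * (p + b * q)) ^ 3 - 4 * (k * q) * (k * (p + b * q)) * (k * (n + b * p))
       + 8 * (k * q)\<^sup>2 * (k * b * n) = - (k ^ 3) * ((p - b * q) * ((b * q)\<^sup>2 - (p\<^sup>2 - 4 * q * n)))"
      for k p n q :: 'a
      by (simp add: algebra_simps eval_nat_numeral)
    have "?R = ?P\<^sup>2 - 4 * Q * (\<alpha> * a\<^sup>2 + \<beta> * a * b + \<gamma> * b\<^sup>2)"
      unfolding Q(1) by (simp add: algebra_simps eval_nat_numeral)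
    then show ?thesis unfolding d0_def d1_def d2_def d3_def using id by metis
  qed
  also have "\<dots> = 0 \<longleftrightarrow> ?P = b * Q \<or> ?L = ?R" using k by simp
  finally show ?thesis .
qed

text \<open>
  If some \<open>x\<^sub>i\<close> is the sum of the other two, it is half of \<open>x\<^sub>1 + x\<^sub>2 + x\<^sub>3 = d\<^sub>1 / d\<^sub>0\<close>. Hence
  \<open>t = - 2 d\<^sub>0 / d\<^sub>1\<close> is a root of \<open>det (t C\<^sub>r + C\<^sub>s)\<close> in the ground field, and the pencil has a singular member
  there (at infinity, if \<open>d\<^sub>1 = 0\<close>).
\<close>

lemma not_poncelet4_pencil_no_singular:
  fixes P :: "'a::field pencil"
  assumes two: "(2::'a) \<noteq> 0" and disc: "has_disc P k0 k1 k2 k3"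
    and nz: "\<And>u v. disc_form k0 k1 k2 k3 u v = 0 \<Longrightarrow> u = 0 \<and> v = 0"
    and neq: "r \<noteq> s"
  shows "\<not> poncelet4 (pencil_conic P r) (pencil_conic P s)"
proof
  assume ponc: "poncelet4 (pencil_conic P r) (pencil_conic P s)"
  define a b c d where defs: "a = pnum r" "b = pden r" "c = pnum s" "d = pden s"
  define d0 where d0: "d0 = k0 * c^3 + k1 * c^2 * d + k2 * c * d^2 + k3 * d^3"
  define d1 where d1: "d1 = 3 * k0 * a * c^2 + k1 * (2*a*c*d + b*c^2) + k2 * (a*d^2 + 2*b*c*d) + 3*k3*b*d^2"
  define d2 where d2: "d2 = 3 * k0 * a^2 * c + k1 * (a^2*d + 2*a*b*c) + k2 * (2*a*b*d + b^2*c) + 3*k3*b^2*d"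
  define d3 where d3: "d3 = k0 * a^3 + k1 * a^2 * b + k2 * a * b^2 + k3 * b^3"
  have smooth: "disc_form k0 k1 k2 k3 (pnum t) (pden t) \<noteq> 0" for t
    using nz[of "pnum t" "pden t"] by (cases t) auto
  have d0nz: "d0 \<noteq> 0" using smooth[of s] by (simp add: d0 disc_form_def defs)
  have d3nz: "d3 \<noteq> 0" using smooth[of r] by (simp add: d3 disc_form_def defs)
  have rel: "d1 ^ 3 - 4 * d0 * d1 * d2 + 8 * d0\<^sup>2 * d3 = 0"
    using poncelet4_pencil[OF two disc smooth defs[symmetric] d0 d1 d2 d3] ponc by simp
  have eight: "(8::'a) \<noteq> 0"
  proof -
    have "(8::'a) = 2 ^ 3" by simp
    then show ?thesis using two by (metis power_not_zero)
  qed
  have d1nz: "d1 \<noteq> 0" using rel d0nz d3nz eight by auto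
  define t where "t = - 2 * d0 / d1"
  have t: "d1 * t = - 2 * d0" using d1nz by (simp add: t_def)
  have "disc_form k0 k1 k2 k3 (a * t + c) (b * t + d) = d0 + d1 * t + d2 * t\<^sup>2 + d3 * t ^ 3"
    unfolding disc_form_def d0 d1 d2 d3 by (simp add: algebra_simps eval_nat_numeral)
  moreover have "d1 ^ 3 * (d0 + d1 * t + d2 * t\<^sup>2 + d3 * t ^ 3)
      = d1 ^ 3 * d0 + d1 ^ 3 * (d1 * t) + d1 * d2 * (d1 * t)\<^sup>2 + d3 * (d1 * t) ^ 3"
    by (simp add: algebra_simps eval_nat_numeral)
  moreover have "\<dots> = - d0 * (d1 ^ 3 - 4 * d0 * d1 * d2 + 8 * d0\<^sup>2 * d3)"
    unfolding t by (simp add: algebra_simps eval_nat_numeral)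
  ultimately have "disc_form k0 k1 k2 k3 (a * t + c) (b * t + d) = 0"
    using rel d1nz by simp
  then have "a * t + c = 0" "b * t + d = 0" using nz by blast+
  then have "r = s" by (intro param_eqI[of s "- t" r]) (auto simp: defs algebra_simps add_eq_0_iff)
  with neq show False by simp
qed

section \<open>Counting pairs of parameters\<close>

lemma two_neq_zero_if_CHAR: "CHAR('a::{field,finite}) \<noteq> 2 \<Longrightarrow> (2::'a) \<noteq> 0"
proof
  assume "CHAR('a) \<noteq> 2" and "(2::'a) = 0"
  then have "CHAR('a) dvd 2" using of_nat_eq_0_iff_char_dvd[of 2, where ?'a = 'a] by simp
  then have "CHAR('a) = 1 \<or> CHAR('a) = 2" using prime_nat_iff two_is_prime_nat by blast
  then have "CHAR('a) = 1" using \<open>CHAR('a) \<noteq> 2\<close> by simp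
  then have "(of_nat 1 :: 'a) = 0" by (metis of_nat_CHAR)
  then show False by simp
qed

lemma two_neq_one: "(2::'a::field) \<noteq> 1"
  by (metis add_cancel_right_right one_add_one one_neq_zero)

lemma card_field_ge_3:
  assumes "(2::'a::{field,finite}) \<noteq> 0"
  shows "CARD('a) \<ge> 3"
proof -
  have "card {0, 1, - 1 :: 'a} = 3"
    using assms by (auto simp: card_insert_if eq_neg_iff_add_eq_0)
  then show ?thesis by (metis card_mono finite subset_UNIV)
qed

lemma nonzero_elements_nonempty [simp]: "- {0::'a::field} \<noteq> {}"
  by (metis ComplI empty_iff one_neq_zero singletonD)

definition distinct_pairs :: "'b set \<Rightarrow> 'b set \<Rightarrow> ('b \<times> 'b) set" where
  "distinct_pairs R S = {(r, s). r \<in> R \<and> s \<in> S \<and> r \<noteq> s}"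

lemma card_distinct_pairs:
  fixes R S :: "'b::finite set"
  assumes "S \<subseteq> R"
  shows "card (distinct_pairs R S) = card S * (card R - 1)"
proof -
  have "distinct_pairs R S = prod.swap ` (SIGMA s:S. R - {s})"
    by (auto simp: distinct_pairs_def image_def)
  then have "card (distinct_pairs R S) = card (SIGMA s:S. R - {s})"
    by (simp add: card_image)
  also have "\<dots> = (\<Sum>s\<in>S. card (R - {s}))" by simp
  also have "\<dots> = (\<Sum>s\<in>S. card R - 1)" using assms by (intro sum.cong) auto
  finally show ?thesis by simp
qed

abbreviation poncelet4_params :: "'a::field pencil \<Rightarrow> 'a option \<Rightarrow> 'a option \<Rightarrow> bool" where
  "poncelet4_params P r s \<equiv> poncelet4 (pencil_conic P r) (pencil_conic P s)"

lemma card_poncelet4_fibres: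
  fixes P :: "'a::{field,finite} pencil"
  shows "card (distinct_pairs R S \<inter> {(r, s). poncelet4_params P r s})
     = (\<Sum>s\<in>S. card {r \<in> R. r \<noteq> s \<and> poncelet4_params P r s})"
proof -
  have "distinct_pairs R S \<inter> {(r, s). poncelet4_params P r s}
     = prod.swap ` (SIGMA s:S. {r \<in> R. r \<noteq> s \<and> poncelet4_params P r s})"
    by (auto simp: distinct_pairs_def image_def)
  then show ?thesis by (simp add: card_image)
qed

lemma poncelet4_prob_is_distinct_pairs:
  fixes P :: "'a::{field,finite} pencil"
  assumes "S \<subseteq> R" "S \<noteq> {}" "card R \<ge> 2"
    and "real (card (distinct_pairs R S \<inter> {(r, s). poncelet4_params P r s}))
       = p * (card S * (real (card R) - 1))"
  shows "poncelet4_prob_is P (distinct_pairs R S) p"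
proof -
  have S: "card S > 0" using assms(2) by (simp add: card_gt_0_iff)
  have card: "card (distinct_pairs R S) = card S * (card R - 1)"
    using card_distinct_pairs[OF assms(1)] .
  have ne: "distinct_pairs R S \<noteq> {}"
    using card S assms(3) by (metis card.empty mult_is_0 less_not_refl diff_is_0_eq not_less_eq_eq
        numeral_2_eq_2 One_nat_def)
  have "real (card (distinct_pairs R S)) = card S * (real (card R) - 1)"
    unfolding card using assms(3) by (simp add: of_nat_diff)
  moreover have "card S * (real (card R) - 1) \<noteq> 0" using S assms(3) by auto
  ultimately show ?thesis unfolding poncelet4_prob_is_def
    using ne assms(4) by (simp add: measure_pmf_of_set)
qed

lemma poncelet4_prob_is_uniform:
  fixes P :: "'a::{field,finite} pencil"
  assumes "S \<subseteq> R" "S \<noteq> {}" "card R \<ge> 2"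
    and "\<And>s. s \<in> S \<Longrightarrow> card {r \<in> R. r \<noteq> s \<and> poncelet4_params P r s} = m"
  shows "poncelet4_prob_is P (distinct_pairs R S) (m / (real (card R) - 1))"
  by (rule poncelet4_prob_is_distinct_pairs[OF assms(1-3)])
     (use assms(3,4) in \<open>simp add: card_poncelet4_fibres\<close>)

text \<open>
  Let \<open>m\<close> be the number of singular conics. Over all parameters \<open>r\<close>, each \<open>s\<close> in \<open>S\<close> has \<open>m\<close> partners,
  and \<open>m\<close> of these \<open>m |S|\<close> pairs have a singular first conic, one for each singular conic. The remaining
  \<open>m (|S| - 1)\<close> pairs are taken from \<open>|S| (|S| - 1)\<close>, so the probability is \<open>m / |S|\<close>.
\<close>

lemma poncelet4_prob_is_smooth:
  fixes P :: "'a::{field,finite} pencil"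
  assumes "card S \<ge> 2"
    and fib: "\<And>s. s \<in> S \<Longrightarrow> card {r. r \<noteq> s \<and> poncelet4_params P r s} = card (- S)"
    and sing: "\<And>r. r \<notin> S \<Longrightarrow> \<exists>!s. s \<in> S \<and> poncelet4_params P r s"
  shows "poncelet4_prob_is P (distinct_pairs S S) (card (- S) / card S)"
proof (rule poncelet4_prob_is_distinct_pairs)
  show "S \<noteq> {}" using assms(1) by auto
  obtain f where f: "\<And>r. r \<notin> S \<Longrightarrow> f r \<in> S \<and> poncelet4_params P r (f r)"
    and f_unique: "\<And>r s. r \<notin> S \<Longrightarrow> s \<in> S \<Longrightarrow> poncelet4_params P r s \<Longrightarrow> s = f r"
    using sing by metis
  have f_neq: "r \<noteq> f r" if "r \<notin> S" for r using f[OF that] that by auto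
  let ?T = "{(r, s). poncelet4_params P r s}"
  have split: "distinct_pairs UNIV S \<inter> ?T
     = (distinct_pairs S S \<inter> ?T) \<union> (\<lambda>r. (r, f r)) ` (- S)"
    using f f_unique f_neq by (auto simp: distinct_pairs_def)
  have "card (distinct_pairs UNIV S \<inter> ?T)
     = card (distinct_pairs S S \<inter> ?T) + card ((\<lambda>r. (r, f r)) ` (- S))"
    unfolding split by (rule card_Un_disjoint) (auto simp: distinct_pairs_def)
  also have "card ((\<lambda>r. (r, f r)) ` (- S)) = card (- S)"
    by (rule card_image) (simp add: inj_on_def)
  also have "card (distinct_pairs UNIV S \<inter> ?T) = card S * card (- S)"
    using fib by (simp add: card_poncelet4_fibres)
  finally have "real (card S * card (- S)) = real (card (distinct_pairs S S \<inter> ?T) + card (- S))"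
    by (rule arg_cong)
  then have "real (card (distinct_pairs S S \<inter> ?T)) = card S * real (card (- S)) - card (- S)"
    by simp
  then show "real (card (distinct_pairs S S \<inter> ?T))
       = card (- S) / card S * (card S * (real (card S) - 1))"
    using assms(1) by (auto simp: field_simps distinct_pairs_def)
qed (use assms(1) in auto)

section \<open>Probabilities for each type of discriminant\<close>

text \<open>
  The discriminant is \<open>\<kappa> \<lambda>\<^sup>2 \<mu>\<close>, so \<open>(x\<^sub>1, x\<^sub>2, x\<^sub>3) = (1, r/s, r/s)\<close> for finite \<open>r\<close>, and the only finite
  partner is \<open>r = s/2\<close>. The parameter at infinity satisfies the relation as well, hence the condition on \<open>R\<close>.
\<close>

lemma poncelet4_prob_double_root_zero:
  fixes P :: "'a::{field,finite} pencil"
  assumes two: "(2::'a) \<noteq> 0" and disc: "has_disc P 0 \<kappa> 0 0" and k: "\<kappa> \<noteq> 0"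
    and R: "Some ` (- {0}) \<subseteq> R" "None \<notin> R"
  shows "poncelet4_prob_is P (distinct_pairs R (Some ` (- {0}))) (1 / (real (card R) - 1))"
proof -
  have disc': "has_disc P 0 (\<kappa> * 1) (\<kappa> * 0) (\<kappa> * 0)" using disc by simp
  have "card (Some ` (- {0}) :: 'a option set) = CARD('a) - 1"
    by (simp add: card_image Compl_eq_Diff_UNIV)
  moreover have "card (Some ` (- {0}) :: 'a option set) \<le> card R"
    using R(1) by (simp add: card_mono)
  ultimately have cR: "card R \<ge> 2" using card_field_ge_3[OF two] by linarith
  have "card {r \<in> R. r \<noteq> s \<and> poncelet4_params P r s} = 1" if s: "s \<in> Some ` (- {0})" for s
  proof -
    obtain x where x: "s = Some x" "x \<noteq> 0" using s by auto
    have "{r \<in> R. r \<noteq> s \<and> poncelet4_params P r s} = {Some (x / 2)}"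
    proof (rule Set.set_eqI)
      fix r :: "'a option"
      show "r \<in> {r \<in> R. r \<noteq> s \<and> poncelet4_params P r s} \<longleftrightarrow> r \<in> {Some (x / 2)}"
      proof (cases r)
        case None
        then show ?thesis using R by auto
      next
        case (Some y)
        have "poncelet4_params P r s \<longleftrightarrow> 2 * y * x = x\<^sup>2 \<or> (x\<^sup>2)\<^sup>2 = 0"
          using poncelet4_pencil_rational_singular[OF two disc' k refl, of x r y 1] x Some by simp
        also have "\<dots> \<longleftrightarrow> y = x / 2"
          using x two by (auto simp: power2_eq_square field_simps)
        finally have p: "poncelet4_params P r s \<longleftrightarrow> y = x / 2" .
        have "x / 2 \<noteq> x" using x two two_neq_one by (simp add: field_simps)
        moreover have "Some (x / 2) \<in> R" by (rule subsetD[OF R(1)]) (use x two in auto)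
        ultimately show ?thesis using p x Some by auto
      qed
    qed
    then show ?thesis by simp
  qed
  from poncelet4_prob_is_uniform[OF R(1) _ cR this] show ?thesis by simp
qed

text \<open>
  The discriminant is \<open>\<kappa> \<lambda> \<mu>\<^sup>2\<close>, so \<open>(x\<^sub>1, x\<^sub>2, x\<^sub>3) = (1, 1, r/s)\<close> for finite \<open>r\<close>, and the only finite
  nonzero partner is \<open>r = 2 s\<close>.
\<close>

lemma poncelet4_prob_double_root_infinity:
  fixes P :: "'a::{field,finite} pencil"
  assumes two: "(2::'a) \<noteq> 0" and disc: "has_disc P 0 0 \<kappa> 0" and k: "\<kappa> \<noteq> 0"
  shows "poncelet4_prob_is P (distinct_pairs (Some ` (- {0})) (Some ` (- {0})))
    (1 / (real CARD('a) - 2))"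
proof -
  have disc': "has_disc P 0 (\<kappa> * 0) (\<kappa> * 1) (\<kappa> * 0)" using disc by simp
  let ?R = "Some ` (- {0}) :: 'a option set"
  have cR: "card ?R = CARD('a) - 1"
    by (simp add: card_image Compl_eq_Diff_UNIV)
  have "card {r \<in> ?R. r \<noteq> s \<and> poncelet4_params P r s} = 1" if s: "s \<in> ?R" for s
  proof -
    obtain x where x: "s = Some x" "x \<noteq> 0" using s by auto
    have "{r \<in> ?R. r \<noteq> s \<and> poncelet4_params P r s} = {Some (2 * x)}"
    proof (rule Set.set_eqI)
      fix r :: "'a option"
      show "r \<in> {r \<in> ?R. r \<noteq> s \<and> poncelet4_params P r s} \<longleftrightarrow> r \<in> {Some (2 * x)}"
      proof (cases r)
        case None
        then show ?thesis by auto
      next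
        case (Some y)
        have "poncelet4_params P r s \<longleftrightarrow> y = 0 \<or> x\<^sup>2 = (y - x)\<^sup>2"
          using poncelet4_pencil_rational_singular[OF two disc' k refl, of x r y 1] x Some by simp
        also have "x\<^sup>2 = (y - x)\<^sup>2 \<longleftrightarrow> y = 0 \<or> y = 2 * x"
          by (auto simp: power2_eq_iff algebra_simps)
        finally have p: "poncelet4_params P r s \<longleftrightarrow> y = 0 \<or> y = 2 * x" by blast
        have "2 * x \<noteq> x" "2 * x \<noteq> 0" using x two two_neq_one by simp_all
        moreover have "Some y \<in> ?R \<longleftrightarrow> y \<noteq> 0" by auto
        ultimately show ?thesis
          unfolding mem_Collect_eq p unfolding x(1) Some option.inject singleton_iff by metis
      qed
    qed
    then show ?thesis by simp
  qed
  from poncelet4_prob_is_uniform[OF subset_refl _ _ this] show ?thesis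
    using cR card_field_ge_3[OF two] by (auto simp: of_nat_diff)
qed

text \<open>
  All \<open>x\<^sub>i\<close> are equal to \<open>1\<close>, and \<open>1 + 1 \<noteq> 1\<close>.
\<close>

lemma poncelet4_prob_triple_root:
  fixes P :: "'a::{field,finite} pencil"
  assumes two: "(2::'a) \<noteq> 0" and disc: "has_disc P 0 0 0 \<kappa>" and k: "\<kappa> \<noteq> 0"
  shows "poncelet4_prob_is P (distinct_pairs (range Some) (range Some)) 0"
proof -
  have disc': "has_disc P 0 (\<kappa> * 0) (\<kappa> * 0) (\<kappa> * 1)" using disc by simp
  let ?R = "range Some :: 'a option set"
  have cR: "card ?R = CARD('a)" by (simp add: card_image)
  have "card {r \<in> ?R. r \<noteq> s \<and> poncelet4_params P r s} = 0" if s: "s \<in> ?R" for s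
  proof -
    have "\<not> poncelet4_params P (Some y) (Some x)" for x y
      using poncelet4_pencil_rational_singular[OF two disc' k refl, of x "Some y" y 1] two_neq_one by simp
    then have "{r \<in> ?R. r \<noteq> s \<and> poncelet4_params P r s} = {}" using s by blast
    then show ?thesis by simp
  qed
  from poncelet4_prob_is_uniform[OF subset_refl _ _ this] show ?thesis
    using cR card_field_ge_3[OF two] by auto
qed

lemma poncelet4_prob_no_root:
  fixes P :: "'a::{field,finite} pencil"
  assumes two: "(2::'a) \<noteq> 0" and disc: "has_disc P k0 k1 k2 k3"
    and nz: "\<And>u v. disc_form k0 k1 k2 k3 u v = 0 \<Longrightarrow> u = 0 \<and> v = 0"
  shows "poncelet4_prob_is P (distinct_pairs UNIV UNIV) 0"
proof -
  have "{r \<in> UNIV. r \<noteq> s \<and> poncelet4_params P r s} = {}" for s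
    using not_poncelet4_pencil_no_singular[OF two disc nz] by blast
  then have "card {r \<in> UNIV. r \<noteq> s \<and> poncelet4_params P r s} = 0" for s by (metis card.empty)
  from poncelet4_prob_is_uniform[OF subset_refl _ _ this] show ?thesis
    using card_field_ge_3[OF two] by auto
qed

lemma homogeneous_linear_solution:
  fixes m n :: "'a::field"
  assumes "m \<noteq> 0 \<or> n \<noteq> 0"
  shows "m * pnum r + n * pden r = 0 \<longleftrightarrow> r = (if m = 0 then None else Some (- n / m))"
  using assms by (cases r) (auto simp: field_simps eq_neg_iff_add_eq_0)

lemma nonsquare_disc_imp_anisotropic:
  fixes \<alpha> \<beta> \<gamma> u v :: "'a::field"
  assumes two: "(2::'a) \<noteq> 0" and nsq: "\<not> is_square (\<beta>\<^sup>2 - 4 * \<alpha> * \<gamma>)"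
    and zero: "\<alpha> * u\<^sup>2 + \<beta> * u * v + \<gamma> * v\<^sup>2 = 0"
  shows "u = 0 \<and> v = 0"
proof -
  have al: "\<alpha> \<noteq> 0" using nsq by auto
  have "(2 * \<alpha> * u + \<beta> * v)\<^sup>2 = 4 * \<alpha> * (\<alpha> * u\<^sup>2 + \<beta> * u * v + \<gamma> * v\<^sup>2) + (\<beta>\<^sup>2 - 4 * \<alpha> * \<gamma>) * v\<^sup>2"
    by (simp add: algebra_simps power2_eq_square)
  then have *: "(2 * \<alpha> * u + \<beta> * v)\<^sup>2 = (\<beta>\<^sup>2 - 4 * \<alpha> * \<gamma>) * v\<^sup>2" using zero by simp
  have "v = 0"
  proof (rule ccontr)
    assume "v \<noteq> 0"
    then have "\<beta>\<^sup>2 - 4 * \<alpha> * \<gamma> = ((2 * \<alpha> * u + \<beta> * v) / v)\<^sup>2" using * by (simp add: power_divide)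
    then show False using nsq by (metis is_nth_powerI)
  qed
  then show ?thesis using zero al by simp
qed

lemma not_square_eq_zero:
  fixes D :: "'a::field"
  assumes "\<not> is_square D" "y\<^sup>2 = D * z\<^sup>2"
  shows "y = 0 \<and> z = 0"
proof -
  have "z = 0"
  proof (rule ccontr)
    assume "z \<noteq> 0"
    then have "D = (y / z)\<^sup>2" using assms(2) by (simp add: power_divide)
    then show False using assms(1) by (metis is_nth_powerI)
  qed
  then show ?thesis using assms(2) by simp
qed

text \<open>
  For the discriminant \<open>\<kappa> \<mu> Q(\<lambda>, \<mu>)\<close> with \<open>Q\<close> irreducible, a square can equal a nonsquare times a square only if both
  squares vanish. This leaves one linear equation for \<open>r\<close>, which has exactly one solution on the
  projective line. For smooth pairs, the solution \<open>r = \<infinity>\<close> has to be removed; it occurs for one \<open>s\<close>.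
\<close>

lemma poncelet4_prob_one_root:
  fixes P :: "'a::{field,finite} pencil"
  assumes two: "(2::'a) \<noteq> 0" and disc: "has_disc P 0 (\<kappa> * \<alpha>) (\<kappa> * \<beta>) (\<kappa> * \<gamma>)" and k: "\<kappa> \<noteq> 0"
    and nsq: "\<not> is_square (\<beta>\<^sup>2 - 4 * \<alpha> * \<gamma>)"
  shows "poncelet4_prob_is P (distinct_pairs (range Some) (range Some)) (1 / real CARD('a))"
    and "poncelet4_prob_is P (distinct_pairs UNIV (range Some)) (1 / real CARD('a))"
proof -
  let ?S = "range Some :: 'a option set"
  have al: "\<alpha> \<noteq> 0" using nsq by auto
  have cS: "card ?S = CARD('a)" by (simp add: card_image)
  have nS: "- ?S = {None}" by auto (metis not_Some_eq range_eqI)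
  have Q: "\<alpha> * x\<^sup>2 + \<beta> * x + \<gamma> \<noteq> 0" for x
    using nonsquare_disc_imp_anisotropic[OF two nsq, of x 1] by auto
  have ponc: "poncelet4_params P r (Some x) \<longleftrightarrow>
      (2 * \<alpha> * x + \<beta>) * pnum r + (\<gamma> - \<alpha> * x\<^sup>2) * pden r = 0" for r x
  proof -
    have "pden r = 0 \<and> pnum r - pden r * x = 0"
      if "(pden r * (\<alpha> * x\<^sup>2 + \<beta> * x + \<gamma>))\<^sup>2 = (\<beta>\<^sup>2 - 4 * \<alpha> * \<gamma>) * (pnum r - pden r * x)\<^sup>2"
      using not_square_eq_zero[OF nsq that] Q[of x] by simp
    then have no: "(pden r * (\<alpha> * x\<^sup>2 + \<beta> * x + \<gamma>))\<^sup>2 \<noteq> (\<beta>\<^sup>2 - 4 * \<alpha> * \<gamma>) * (pnum r - pden r * x)\<^sup>2"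
      by (cases r) auto
    have "poncelet4_params P r (Some x) \<longleftrightarrow>
       2 * \<alpha> * pnum r * x + \<beta> * (pnum r + pden r * x) + 2 * \<gamma> * pden r
         = pden r * (\<alpha> * x\<^sup>2 + \<beta> * x + \<gamma>)"
      using poncelet4_pencil_rational_singular[OF two disc k refl Q refl refl] no by blast
    also have "\<dots> \<longleftrightarrow> (2 * \<alpha> * x + \<beta>) * pnum r + (\<gamma> - \<alpha> * x\<^sup>2) * pden r = 0"
      by (simp add: algebra_simps)
    finally show ?thesis .
  qed
  have "2 * \<alpha> * x + \<beta> \<noteq> 0 \<or> \<gamma> - \<alpha> * x\<^sup>2 \<noteq> 0" for x
  proof (rule ccontr)
    assume "\<not> ?thesis"
    then have "\<beta> = - 2 * \<alpha> * x" "\<gamma> = \<alpha> * x\<^sup>2" by (auto simp: eq_neg_iff_add_eq_0 add.commute)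
    then have "\<beta>\<^sup>2 - 4 * \<alpha> * \<gamma> = 0\<^sup>2" by (simp add: power2_eq_square)
    then show False using nsq by (metis is_nth_powerI)
  qed
  note lin = homogeneous_linear_solution[OF this]
  have fib: "card {r. r \<noteq> s \<and> poncelet4_params P r s} = 1" if s: "s \<in> ?S" for s
  proof -
    obtain x where x: "s = Some x" using s by auto
    have "\<not> poncelet4_params P s s"
      using Q[of x] unfolding x ponc by (simp add: algebra_simps power2_eq_square)
    then have "{r. r \<noteq> s \<and> poncelet4_params P r s} = {r. poncelet4_params P r s}" by auto
    then show ?thesis unfolding x ponc lin by simp
  qed
  show "poncelet4_prob_is P (distinct_pairs UNIV ?S) (1 / real CARD('a))"
    using poncelet4_prob_is_uniform[of ?S UNIV P 1] fib card_field_ge_3[OF two] by simp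
  have "poncelet4_prob_is P (distinct_pairs ?S ?S) (card (- ?S) / card ?S)"
  proof (rule poncelet4_prob_is_smooth)
    show "card ?S \<ge> 2" using cS card_field_ge_3[OF two] by simp
    show "card {r. r \<noteq> s \<and> poncelet4_params P r s} = card (- ?S)" if "s \<in> ?S" for s
      using fib[OF that] nS by simp
    show "\<exists>!s. s \<in> ?S \<and> poncelet4_params P r s" if "r \<notin> ?S" for r
    proof
      have r: "r = None" using that by (cases r) auto
      show "Some (- \<beta> / (2 * \<alpha>)) \<in> ?S \<and> poncelet4_params P r (Some (- \<beta> / (2 * \<alpha>)))"
        unfolding r ponc using two al by simp
      show "s = Some (- \<beta> / (2 * \<alpha>))" if "s \<in> ?S \<and> poncelet4_params P r s" for s
        using that two al unfolding r by (auto simp: ponc field_simps eq_neg_iff_add_eq_0)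
    qed
  qed
  then show "poncelet4_prob_is P (distinct_pairs ?S ?S) (1 / real CARD('a))"
    by (simp add: nS cS)
qed

text \<open>
  The discriminant \<open>\<kappa> \<mu> (\<lambda> - u \<mu>) (\<lambda> - w \<mu>)\<close> has the simple zeros \<open>\<infinity>\<close>, \<open>u\<close> and \<open>w\<close>. The
  relation is then a disjunction of three linear equations for \<open>r\<close>, whose solutions are distinct. If \<open>r\<close> is
  one of the zeros, then one \<open>x\<^sub>i\<close> vanishes and the relation says that the other two add up to zero, which is
  a linear equation for \<open>s\<close> with exactly one solution.
\<close>

lemma poncelet4_prob_three_roots:
  fixes P :: "'a::{field,finite} pencil"
  assumes two: "(2::'a) \<noteq> 0"
    and disc: "has_disc P 0 \<kappa> (- \<kappa> * (u + w)) (\<kappa> * u * w)" and k: "\<kappa> \<noteq> 0" and uw: "u \<noteq> w"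
  shows "CARD('a) > 3 \<Longrightarrow> poncelet4_prob_is P
      (distinct_pairs (Some ` (- {u, w})) (Some ` (- {u, w}))) (3 / (real CARD('a) - 2))"
    and "poncelet4_prob_is P (distinct_pairs UNIV (Some ` (- {u, w}))) (3 / real CARD('a))"
proof -
  let ?S = "Some ` (- {u, w}) :: 'a option set"
  have disc': "has_disc P 0 (\<kappa> * 1) (\<kappa> * (- (u + w))) (\<kappa> * (u * w))" 
    using disc by (simp only: mult_minus_left mult_minus_right mult.assoc mult_1_right)
  have cS: "card ?S = CARD('a) - 2"
    using uw by (simp add: card_image Compl_eq_Diff_UNIV card_Diff_subset)
  have nS: "- ?S = {None, Some u, Some w}"
    by (auto simp: image_iff)
  have cnS: "card (- ?S) = 3" using uw by (simp add: nS)
  have ponc: "poncelet4_params P r (Some x) \<longleftrightarrow>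
      (2 * x - u - w) * pnum r + (u * w - x\<^sup>2) * pden r = 0 \<or>
      (u - w) * (pnum r - x * pden r) = - (x - u) * (x - w) * pden r \<or>
      (u - w) * (pnum r - x * pden r) = (x - u) * (x - w) * pden r" 
    if x: "x \<noteq> u" "x \<noteq> w" for r x
  proof -
    have Qeq: "1 * x\<^sup>2 + (- (u + w)) * x + u * w = (x - u) * (x - w)"
      by (simp add: algebra_simps power2_eq_square)
    have "poncelet4_params P r (Some x) \<longleftrightarrow>
       2 * 1 * pnum r * x + (- (u + w)) * (pnum r + pden r * x) + 2 * (u * w) * pden r
         = pden r * ((x - u) * (x - w)) \<or>
       (pden r * ((x - u) * (x - w)))\<^sup>2 = ((- (u + w))\<^sup>2 - 4 * 1 * (u * w)) * (pnum r - pden r * x)\<^sup>2"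
      by (rule poncelet4_pencil_rational_singular[OF two disc' k Qeq[symmetric] _ refl refl])
         (use x in auto)
    also have "((- (u + w))\<^sup>2 - 4 * 1 * (u * w)) * (pnum r - pden r * x)\<^sup>2
       = ((u - w) * (pnum r - x * pden r))\<^sup>2"
      by (simp add: algebra_simps power2_eq_square)
    also have "(pden r * ((x - u) * (x - w)))\<^sup>2 = ((u - w) * (pnum r - x * pden r))\<^sup>2 \<longleftrightarrow>
       (u - w) * (pnum r - x * pden r) = - (x - u) * (x - w) * pden r \<or>
      (u - w) * (pnum r - x * pden r) = (x - u) * (x - w) * pden r"
      unfolding power2_eq_iff by (auto simp: algebra_simps)
    also have "2 * 1 * pnum r * x + (- (u + w)) * (pnum r + pden r * x) + 2 * (u * w) * pden r
         = pden r * ((x - u) * (x - w)) \<longleftrightarrow>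
       (2 * x - u - w) * pnum r + (u * w - x\<^sup>2) * pden r = 0"
      by (simp add: algebra_simps power2_eq_square)
    finally show ?thesis .
  qed
  have fib: "card {r. r \<noteq> s \<and> poncelet4_params P r s} = 3" if s: "s \<in> ?S" for s
  proof -
    obtain x where x: "s = Some x" "x \<noteq> u" "x \<noteq> w" using s by auto
    \<comment> \<open>The second and the third equation have the solutions \<open>x - q\<close> and \<open>x + q\<close>.\<close>
    define q where "q = (x - u) * (x - w) / (u - w)"
    have q: "(u - w) * q = (x - u) * (x - w)" using uw by (simp add: q_def)
    have qnz: "q \<noteq> 0" using x uw by (simp add: q_def)
    define r1 where "r1 = (if 2 * x - u - w = 0 then None else Some (- (u * w - x\<^sup>2) / (2 * x - u - w)))"
    have "2 * x - u - w \<noteq> 0 \<or> u * w - x\<^sup>2 \<noteq> 0"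
    proof (rule ccontr)
      assume "\<not> ?thesis"
      then have "w = 2 * x - u" "u * w = x\<^sup>2" by (simp_all add: eq_diff_eq diff_diff_eq)
      moreover have "(x - u)\<^sup>2 = x\<^sup>2 - u * (2 * x - u)"
        by (simp add: algebra_simps power2_eq_square)
      ultimately have "(x - u)\<^sup>2 = 0" by simp
      then show False using x by simp
    qed
    note lin = homogeneous_linear_solution[OF this, folded r1_def]
    have 2: "(u - w) * (pnum r - x * pden r) = - (x - u) * (x - w) * pden r \<longleftrightarrow> r = Some (x - q)" for r
    proof (cases r)
      case (Some y)
      have "(u - w) * (y - x) = - (x - u) * (x - w) \<longleftrightarrow> (u - w) * (y - x) = (u - w) * (- q)"
        by (simp only: mult_minus_left mult_minus_right q)
      also have "\<dots> \<longleftrightarrow> y - x = - q" unfolding mult_cancel_left using uw by simp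
      also have "\<dots> \<longleftrightarrow> y = x - q" by (auto simp: diff_eq_eq)
      finally show ?thesis using Some by simp
    qed (use uw in simp)
    have 3: "(u - w) * (pnum r - x * pden r) = (x - u) * (x - w) * pden r \<longleftrightarrow> r = Some (x + q)" for r
    proof (cases r)
      case (Some y)
      have "(u - w) * (y - x) = (x - u) * (x - w) \<longleftrightarrow> (u - w) * (y - x) = (u - w) * q"
        by (simp only: q)
      also have "\<dots> \<longleftrightarrow> y - x = q" unfolding mult_cancel_left using uw by simp
      also have "\<dots> \<longleftrightarrow> y = x + q" by (auto simp: diff_eq_eq)
      finally show ?thesis using Some by simp
    qed (use uw in simp)
    have set: "{r. poncelet4_params P r s} = {r1, Some (x - q), Some (x + q)}"
      unfolding x ponc[OF x(2,3)] lin 2 3 by auto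
    have "x - q \<noteq> x + q" using qnz two
      by (metis add_cancel_right_right add_diff_cancel_left' diff_add_cancel mult_2 mult_eq_0_iff
           add.assoc)
    moreover have "r1 \<noteq> Some (x - q)"
    proof
      assume "r1 = Some (x - q)"
      then have "(2 * x - u - w) * (x - q) + (u * w - x\<^sup>2) = 0"
        using lin[of "Some (x - q)"] by simp
      then have "(u - w) * ((2 * x - u - w) * (x - q) + (u * w - x\<^sup>2)) = 0" by simp
      moreover have "(u - w) * ((2 * x - u - w) * (x - q) + (u * w - x\<^sup>2))
         = (u - w) * ((2 * x - u - w) * x + (u * w - x\<^sup>2)) - (2 * x - u - w) * ((u - w) * q)"
        by (simp add: algebra_simps)
      moreover have "\<dots> = - (2 * (x - u) * ((x - u) * (x - w)))"
        unfolding q by (simp add: algebra_simps power2_eq_square)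
      ultimately show False using x two by simp
    qed
    moreover have "r1 \<noteq> Some (x + q)"
    proof
      assume "r1 = Some (x + q)"
      then have "(2 * x - u - w) * (x + q) + (u * w - x\<^sup>2) = 0"
        using lin[of "Some (x + q)"] by simp
      then have "(u - w) * ((2 * x - u - w) * (x + q) + (u * w - x\<^sup>2)) = 0" by simp
      moreover have "(u - w) * ((2 * x - u - w) * (x + q) + (u * w - x\<^sup>2))
         = (u - w) * ((2 * x - u - w) * x + (u * w - x\<^sup>2)) + (2 * x - u - w) * ((u - w) * q)"
        by (simp add: algebra_simps)
      moreover have "\<dots> = 2 * (x - w) * ((x - u) * (x - w))"
        unfolding q by (simp add: algebra_simps power2_eq_square)
      ultimately show False using x two by simp
    qed
    ultimately have "card {r. poncelet4_params P r s} = 3" unfolding set by simp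
    moreover have "\<not> poncelet4_params P s s"
    proof -
      have "(2 * x - u - w) * x + (u * w - x\<^sup>2) = (x - u) * (x - w)"
        by (simp add: algebra_simps power2_eq_square)
      then show ?thesis using x by (simp add: ponc)
    qed
    then have "{r. r \<noteq> s \<and> poncelet4_params P r s} = {r. poncelet4_params P r s}" by auto
    ultimately show ?thesis by simp
  qed
  have "?S \<noteq> {}" using cS card_field_ge_3[OF two] by (metis card.empty diff_is_0_eq not_less_eq_eq
        numeral_2_eq_2 numeral_3_eq_3)
  then show "poncelet4_prob_is P (distinct_pairs UNIV ?S) (3 / real CARD('a))"
    using poncelet4_prob_is_uniform[of ?S UNIV P 3] fib card_field_ge_3[OF two] by simp
  assume "CARD('a) > 3"
  have "poncelet4_prob_is P (distinct_pairs ?S ?S) (card (- ?S) / card ?S)"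
  proof (rule poncelet4_prob_is_smooth)
    show "card ?S \<ge> 2" using cS \<open>CARD('a) > 3\<close> by simp
    show "card {r. r \<noteq> s \<and> poncelet4_params P r s} = card (- ?S)" if "s \<in> ?S" for s
      using fib[OF that] cnS by simp
    show "\<exists>!s. s \<in> ?S \<and> poncelet4_params P r s" if "r \<notin> ?S" for r
    proof -
      have *: "\<exists>!s. s \<in> ?S \<and> poncelet4_params P r s"
        if "y \<noteq> u" "y \<noteq> w" "\<And>x. x \<noteq> u \<Longrightarrow> x \<noteq> w \<Longrightarrow> poncelet4_params P r (Some x) \<longleftrightarrow> x = y" for y
        using that by (intro ex1I[of _ "Some y"]) auto
      have "r \<in> - ?S" using that by (simp only: Compl_iff not_False_eq_True)
      then have "r = None \<or> r = Some u \<or> r = Some w"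
        unfolding nS insert_iff empty_iff by simp
      then consider "r = None" | "r = Some u" | "r = Some w" by blast
      then show ?thesis
      proof cases
        case 1
        have "poncelet4_params P r (Some x) \<longleftrightarrow> x = (u + w) / 2" if "x \<noteq> u" "x \<noteq> w" for x
          unfolding ponc[OF that] using 1 uw two by (auto simp: field_simps)
        moreover have "(u + w) / 2 \<noteq> u" "(u + w) / 2 \<noteq> w" using uw two by (auto simp: field_simps)
        ultimately show ?thesis by (rule *[rotated 2])
      next
        case 2
        have "poncelet4_params P r (Some x) \<longleftrightarrow> x = 2 * w - u" if x: "x \<noteq> u" "x \<noteq> w" for x
        proof -
          have nz: "(x - u) * (x - u) \<noteq> 0" using x by simp
          have ids: "(2 * x - u - w) * u + (u * w - x\<^sup>2) = - ((x - u) * (x - u))"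
            "(u - w) * (u - x) - (- (x - u) * (x - w)) = ((x - u) * (x - u))"
            "(u - w) * (u - x) - (x - u) * (x - w) = ((x - u) * (2 * w - u - x))"
            by (simp_all add: algebra_simps power2_eq_square)
          have "(2 * x - u - w) * u + (u * w - x\<^sup>2) \<noteq> 0" using ids(1) nz by simp
          moreover have "(u - w) * (u - x) \<noteq> (- (x - u) * (x - w))"
            using ids(2) nz by (metis right_minus_eq neg_equal_0_iff_equal)
          moreover have "(u - w) * (u - x) = (x - u) * (x - w) \<longleftrightarrow> x = 2 * w - u"
          proof -
            have "(u - w) * (u - x) = (x - u) * (x - w) \<longleftrightarrow> ((x - u) * (2 * w - u - x)) = 0"
              unfolding ids(3)[symmetric] right_minus_eq ..
            also have "\<dots> \<longleftrightarrow> 2 * w - u - x = 0" using x by simp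
            finally show ?thesis by auto
          qed
          ultimately show ?thesis
            unfolding ponc[OF x] 2 pnum_simps pden_simps mult_1_right by blast
        qed
        moreover have "2 * w - u \<noteq> u" "2 * w - u \<noteq> w" using uw two
          by (auto simp: algebra_simps simp flip: mult_2)
        ultimately show ?thesis by (rule *[rotated 2])
      next
        case 3
        have "poncelet4_params P r (Some x) \<longleftrightarrow> x = 2 * u - w" if x: "x \<noteq> u" "x \<noteq> w" for x
        proof -
          have nz: "(x - w) * (x - w) \<noteq> 0" using x by simp
          have ids: "(2 * x - u - w) * w + (u * w - x\<^sup>2) = - ((x - w) * (x - w))"
            "(u - w) * (w - x) - (x - u) * (x - w) = - ((x - w) * (x - w))"
            "(u - w) * (w - x) - (- (x - u) * (x - w)) = - ((x - w) * (2 * u - w - x))"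
            by (simp_all add: algebra_simps power2_eq_square)
          have "(2 * x - u - w) * w + (u * w - x\<^sup>2) \<noteq> 0" using ids(1) nz by simp
          moreover have "(u - w) * (w - x) \<noteq> (x - u) * (x - w)"
            using ids(2) nz by (metis right_minus_eq neg_equal_0_iff_equal)
          moreover have "(u - w) * (w - x) = (- (x - u) * (x - w)) \<longleftrightarrow> x = 2 * u - w"
          proof -
            have "(u - w) * (w - x) = (- (x - u) * (x - w)) \<longleftrightarrow> - ((x - w) * (2 * u - w - x)) = 0"
              unfolding ids(3)[symmetric] right_minus_eq ..
            also have "\<dots> \<longleftrightarrow> 2 * u - w - x = 0" using x by simp
            finally show ?thesis by auto
          qed
          ultimately show ?thesis
            unfolding ponc[OF x] 3 pnum_simps pden_simps mult_1_right by blast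
        qed
        moreover have "2 * u - w \<noteq> u" "2 * u - w \<noteq> w" using uw two
          by (auto simp: algebra_simps simp flip: mult_2)
        ultimately show ?thesis by (rule *[rotated 2])
      qed
    qed
  qed
  then show "poncelet4_prob_is P (distinct_pairs ?S ?S) (3 / (real CARD('a) - 2))"
    using cS \<open>CARD('a) > 3\<close> by (simp add: cnS of_nat_diff)
qed

section \<open>Lines and tangency over the algebraic closure\<close>

lemma mem_line_of:
  "v \<in> line_of l \<longleftrightarrow> l $ 1 * v $ 1 + l $ 2 * v $ 2 + l $ 3 * v $ 3 = 0"
  by (simp add: line_of_def scalar_product_def sum_3)

lemma vector_3_eta: "(l :: 'b::zero^3) = vector [l $ 1, l $ 2, l $ 3]"
  by (simp add: vec_eq_iff forall_3)

lemma vector_3_eq_0_iff [simp]: "(vector [x, y, z] :: 'b::zero^3) = 0 \<longleftrightarrow> x = 0 \<and> y = 0 \<and> z = 0"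
  by (simp add: vec_eq_iff forall_3)

text \<open>
  Testing the inclusion on the vectors \<open>(l\<^sub>2, - l\<^sub>1, 0)\<close>, \<open>(l\<^sub>3, 0, - l\<^sub>1)\<close> and \<open>(0, l\<^sub>3, - l\<^sub>2)\<close> shows that all
  minors of \<open>(l, m)\<close> vanish.
\<close>

lemma line_of_subsetD:
  assumes "line_of l \<subseteq> line_of m" "l \<noteq> 0"
  shows "\<exists>k. m = k *s l"
proof -
  have "m $ 1 * v1 + m $ 2 * v2 + m $ 3 * v3 = 0"
    if "l $ 1 * v1 + l $ 2 * v2 + l $ 3 * v3 = 0" for v1 v2 v3
    using subsetD[OF assms(1), of "vector [v1, v2, v3]"] that
    by (simp add: mem_line_of)
  note * = this
  have minors: "m $ 1 * l $ 2 = m $ 2 * l $ 1" "m $ 1 * l $ 3 = m $ 3 * l $ 1"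
    "m $ 2 * l $ 3 = m $ 3 * l $ 2"
    using *[of "l $ 2" "- (l $ 1)" 0] *[of "l $ 3" 0 "- (l $ 1)"] *[of 0 "l $ 3" "- (l $ 2)"]
    by (simp_all add: algebra_simps)
  obtain i where i: "l $ i \<noteq> 0" using assms(2) by (auto simp: vec_eq_iff)
  have "m $ j * l $ i = m $ i * l $ j" for j
    using minors exhaust_3[of i] exhaust_3[of j] by (elim disjE) simp_all
  then have "m = (m $ i / l $ i) *s l" using i by (simp add: vec_eq_iff field_simps)
  then show ?thesis by blast
qed

lemma line_of_scale:
  assumes "k \<noteq> 0"
  shows "line_of (k *s l) = line_of l"
  using assms by (auto simp: line_of_def scalar_product_def mult.assoc simp flip: sum_distrib_left)

lemma line_of_subset_imp_eq:
  assumes "line_of l \<subseteq> line_of m" "l \<noteq> 0" "m \<noteq> 0"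
  shows "line_of l = line_of m"
proof -
  obtain k where "m = k *s l" using line_of_subsetD[OF assms(1,2)] by blast
  moreover from this have "k \<noteq> 0" using assms(3) by auto
  ultimately show ?thesis by (simp add: line_of_scale)
qed

text \<open>
  Lines are represented by subspaces, and a subspace that is contained in the union of two subspaces is
  contained in one of them. Therefore the two components of a reducible conic are determined by its point set.
\<close>

lemma line_subset_union_lines:
  assumes "is_line L" "is_line M" "is_line N" "L \<subseteq> M \<union> N"
  shows "L = M \<or> L = N"
proof -
  obtain l m n where lines: "L = line_of l" "M = line_of m" "N = line_of n"
    and nz: "l \<noteq> 0" "m \<noteq> 0" "n \<noteq> 0"
    using assms(1-3) by (auto simp: is_line_def)
  have add: "u + v \<in> line_of k" if "u \<in> line_of k" "v \<in> line_of k" for u v k :: "'a alg_closure^3"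
    using that by (simp add: line_of_def scalar_product_def algebra_simps sum.distrib)
  have diff: "u - v \<in> line_of k" if "u \<in> line_of k" "v \<in> line_of k" for u v k :: "'a alg_closure^3"
    using that by (simp add: line_of_def scalar_product_def algebra_simps sum_subtractf)
  have "L \<subseteq> M \<or> L \<subseteq> N"
  proof (rule ccontr)
    assume "\<not> ?thesis"
    then obtain u v where uv: "u \<in> L" "u \<notin> M" "v \<in> L" "v \<notin> N" by blast
    then have "u \<in> N" "v \<in> M" "u + v \<in> M \<union> N" using assms(4) add lines by blast+
    then show False
      using uv diff[of "u + v" m v] diff[of "u + v" n u] lines by auto
  qed
  then show ?thesis using line_of_subset_imp_eq lines nz by blast
qed

lemma map_matrix_qform_matrix:
  "map_matrix to_ac (qform_matrix a b c f g h)
    = qform_matrix (to_ac a) (to_ac b) (to_ac c) (to_ac f) (to_ac g) (to_ac h)"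
  by (simp add: qform_matrix_def vec_eq_iff forall_3)

lemma conic_points_line_pair:
  fixes a b c f g h :: "'a::field"
  assumes two: "(2::'a) \<noteq> 0"
    and "to_ac a = l1 * m1" "to_ac b = l2 * m2" "to_ac c = l3 * m3"
    and "to_ac f = l1 * m2 + l2 * m1" "to_ac g = l1 * m3 + l3 * m1" "to_ac h = l2 * m3 + l3 * m2"
  shows "conic_points (qform_matrix a b c f g h)
    = line_of (vector [l1, l2, l3]) \<union> line_of (vector [m1, m2, m3])"
proof (rule Set.set_eqI)
  fix v :: "'a alg_closure^3"
  have two': "(2::'a alg_closure) \<noteq> 0" using two by (metis to_ac_eq_0_iff to_ac_numeral)
  have "qform (map_matrix to_ac (qform_matrix a b c f g h)) v
     = qform (map_matrix to_ac (qform_matrix a b c f g h)) (vector [v $ 1, v $ 2, v $ 3])"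
    by (simp flip: vector_3_eta)
  also have "\<dots> = (l1 * v $ 1 + l2 * v $ 2 + l3 * v $ 3) * (m1 * v $ 1 + m2 * v $ 2 + m3 * v $ 3)"
    unfolding map_matrix_qform_matrix qform_qform_matrix[OF two'] assms(2-)
    by (simp add: algebra_simps power2_eq_square)
  finally show "v \<in> conic_points (qform_matrix a b c f g h) \<longleftrightarrow>
      v \<in> line_of (vector [l1, l2, l3]) \<union> line_of (vector [m1, m2, m3])"
    by (simp add: conic_points_def mem_line_of)
qed

text \<open>
  The discriminant of a ternary quadratic form, four times the determinant of its matrix. This normalization and
  that of \<open>dual_qform\<close> below avoid all divisions by two.
\<close>

definition qform_disc :: "'a::comm_ring_1 \<Rightarrow> 'a \<Rightarrow> 'a \<Rightarrow> 'a \<Rightarrow> 'a \<Rightarrow> 'a \<Rightarrow> 'a" where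
  "qform_disc a b c f g h = 4 * a * b * c + f * g * h - a * h\<^sup>2 - b * g\<^sup>2 - c * f\<^sup>2"

text \<open>
  The dual quadratic form: four times \<open>l\<^sup>T adj(B) l\<close> for the matrix \<open>B\<close> of the form with the given coefficients.
\<close>

definition dual_qform ::
    "'a::comm_ring_1 \<Rightarrow> 'a \<Rightarrow> 'a \<Rightarrow> 'a \<Rightarrow> 'a \<Rightarrow> 'a \<Rightarrow> 'a \<Rightarrow> 'a \<Rightarrow> 'a \<Rightarrow> 'a" where
  "dual_qform a b c f g h l1 l2 l3 =
     (4 * b * c - h\<^sup>2) * l1\<^sup>2 + (4 * a * c - g\<^sup>2) * l2\<^sup>2 + (4 * a * b - f\<^sup>2) * l3\<^sup>2
     + 2 * (g * h - 2 * c * f) * l1 * l2 + 2 * (f * h - 2 * b * g) * l1 * l3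
     + 2 * (f * g - 2 * a * h) * l2 * l3"

lemma four_neq_zero: "(2::'a::field) \<noteq> 0 \<Longrightarrow> (4::'a) \<noteq> 0"
  by (metis mult_2 mult_eq_0_iff numeral_Bit0)

lemma qform_matrix_double:
  assumes "(2::'a::field) \<noteq> 0"
  shows "qform_matrix a b c (2 * f) (2 * g) (2 * h) =
    (vector [vector [a, f, g], vector [f, b, h], vector [g, h, c]] :: 'a^3^3)"
  using assms by (simp add: qform_matrix_def)

lemma det_qform_matrix:
  assumes "(2::'a::field) \<noteq> 0"
  shows "4 * det (qform_matrix a b c f g h :: 'a^3^3) = qform_disc a b c f g h"
proof -
  have "4 * det (qform_matrix a b c (2 * f) (2 * g) (2 * h)) = qform_disc a b c (2 * f) (2 * g) (2 * h)"
    for f g h :: 'a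
    unfolding qform_matrix_double[OF assms] det_3 qform_disc_def
    by (simp add: algebra_simps power2_eq_square)
  from this[of "f / 2" "g / 2" "h / 2"] show ?thesis using assms by simp
qed

text \<open>
  If \<open>l\<close> is proportional to \<open>B p\<close>, then \<open>p\<close> is proportional to \<open>adj(B) l\<close>, so the incidence of \<open>p\<close> with the
  tangent line \<open>l\<close> reads \<open>l\<^sup>T adj(B) l = 0\<close>. Conversely \<open>p = adj(B) l\<close> is then the point of tangency.
\<close>

lemma tangent_to_iff:
  fixes a b c f g h :: "'a::field"
  assumes two: "(2::'a) \<noteq> 0" and disc: "qform_disc a b c f g h \<noteq> 0"
    and l: "l1 \<noteq> 0 \<or> l2 \<noteq> 0 \<or> l3 \<noteq> 0"
  shows "tangent_to (line_of (vector [l1, l2, l3])) (qform_matrix a b c f g h) \<longleftrightarrow>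
    dual_qform (to_ac a) (to_ac b) (to_ac c) (to_ac f) (to_ac g) (to_ac h) l1 l2 l3 = 0"
proof -
  have two': "(2::'a alg_closure) \<noteq> 0" using two by (metis to_ac_eq_0_iff to_ac_numeral)
  define A B C F G H :: "'a alg_closure"
    where defs: "A = to_ac a" "B = to_ac b" "C = to_ac c" "F = to_ac (f / 2)" "G = to_ac (g / 2)" "H = to_ac (h / 2)"
  have FGH: "to_ac f = 2 * F" "to_ac g = 2 * G" "to_ac h = 2 * H"
    using two' by (simp_all add: defs)
  define D where "D = A * B * C + 2 * F * G * H - A * H\<^sup>2 - B * G\<^sup>2 - C * F\<^sup>2"
  have "to_ac (qform_disc a b c f g h) = 4 * D"
    by (simp add: qform_disc_def D_def FGH) (simp add: defs(1-3) algebra_simps power2_eq_square)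
  then have D: "D \<noteq> 0" using disc by (metis mult_zero_right to_ac_eq_0_iff)
  define q where "q l1 l2 l3 = (B * C - H\<^sup>2) * l1\<^sup>2 + (A * C - G\<^sup>2) * l2\<^sup>2 + (A * B - F\<^sup>2) * l3\<^sup>2
     + 2 * (G * H - C * F) * l1 * l2 + 2 * (F * H - B * G) * l1 * l3 + 2 * (F * G - A * H) * l2 * l3"
    for l1 l2 l3
  have "dual_qform (to_ac a) (to_ac b) (to_ac c) (to_ac f) (to_ac g) (to_ac h) l1 l2 l3 = 4 * q l1 l2 l3"
    by (simp add: dual_qform_def q_def FGH flip: defs(1-3)) (simp add: algebra_simps power2_eq_square)
  moreover have "(4::'a alg_closure) \<noteq> 0"
  proof -
    have "(4::'a alg_closure) = 2 * 2" by simp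
    then show ?thesis using two' by (metis mult_eq_0_iff)
  qed
  ultimately have dual: "dual_qform (to_ac a) (to_ac b) (to_ac c) (to_ac f) (to_ac g) (to_ac h) l1 l2 l3 = 0
     \<longleftrightarrow> q l1 l2 l3 = 0" by simp
  have M: "map_matrix to_ac (qform_matrix a b c f g h)
     = vector [vector [A, F, G], vector [F, B, H], vector [G, H, C]]"
    unfolding map_matrix_qform_matrix FGH qform_matrix_double[OF two'] by (simp add: defs)
  have Mp: "map_matrix to_ac (qform_matrix a b c f g h) *v p
     = vector [A * p $ 1 + F * p $ 2 + G * p $ 3, F * p $ 1 + B * p $ 2 + H * p $ 3,
               G * p $ 1 + H * p $ 2 + C * p $ 3]" for p
    unfolding M by (simp add: matrix_vector_mult_def vec_eq_iff forall_3 sum_3)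
  have points: "p \<in> conic_points (qform_matrix a b c f g h) \<longleftrightarrow>
       p $ 1 * (A * p $ 1 + F * p $ 2 + G * p $ 3) + p $ 2 * (F * p $ 1 + B * p $ 2 + H * p $ 3)
       + p $ 3 * (G * p $ 1 + H * p $ 2 + C * p $ 3) = 0" for p
    unfolding conic_points_def qform_def Mp mem_Collect_eq
    by (simp add: scalar_product_def sum_3)
  show ?thesis unfolding dual
  proof
    assume "tangent_to (line_of (vector [l1, l2, l3])) (qform_matrix a b c f g h)"
    then obtain p where p: "p \<noteq> 0" "p \<in> conic_points (qform_matrix a b c f g h)"
      "line_of (vector [l1, l2, l3]) = line_of (map_matrix to_ac (qform_matrix a b c f g h) *v p)"
      unfolding tangent_to_def by blast
    obtain p1 p2 p3 where pv: "p = vector [p1, p2, p3]" using vector_3_eta[of p] by blast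
    have "\<exists>k. map_matrix to_ac (qform_matrix a b c f g h) *v p = k *s vector [l1, l2, l3]"
      by (rule line_of_subsetD) (use p(3) l in auto)
    then obtain k where k: "A * p1 + F * p2 + G * p3 = k * l1" "F * p1 + B * p2 + H * p3 = k * l2"
      "G * p1 + H * p2 + C * p3 = k * l3"
      unfolding Mp by (auto simp: vec_eq_iff forall_3 pv)
    have 1: "D * p1 = k * ((B * C - H\<^sup>2) * l1 + (G * H - C * F) * l2 + (F * H - B * G) * l3)"
    proof -
      have "D * p1 = (B * C - H\<^sup>2) * (A * p1 + F * p2 + G * p3) + (G * H - C * F) * (F * p1 + B * p2 + H * p3)
         + (F * H - B * G) * (G * p1 + H * p2 + C * p3)"
        by (simp add: D_def algebra_simps power2_eq_square)
      then show ?thesis unfolding k by (simp add: algebra_simps)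
    qed
    have 2: "D * p2 = k * ((G * H - C * F) * l1 + (A * C - G\<^sup>2) * l2 + (F * G - A * H) * l3)"
    proof -
      have "D * p2 = (G * H - C * F) * (A * p1 + F * p2 + G * p3) + (A * C - G\<^sup>2) * (F * p1 + B * p2 + H * p3)
         + (F * G - A * H) * (G * p1 + H * p2 + C * p3)"
        by (simp add: D_def algebra_simps power2_eq_square)
      then show ?thesis unfolding k by (simp add: algebra_simps)
    qed
    have 3: "D * p3 = k * ((F * H - B * G) * l1 + (F * G - A * H) * l2 + (A * B - F\<^sup>2) * l3)"
    proof -
      have "D * p3 = (F * H - B * G) * (A * p1 + F * p2 + G * p3) + (F * G - A * H) * (F * p1 + B * p2 + H * p3)
         + (A * B - F\<^sup>2) * (G * p1 + H * p2 + C * p3)"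
        by (simp add: D_def algebra_simps power2_eq_square)
      then show ?thesis unfolding k by (simp add: algebra_simps)
    qed
    have k0: "k \<noteq> 0"
    proof
      assume "k = 0"
      then have "p1 = 0" "p2 = 0" "p3 = 0" using 1 2 3 D by simp_all
      then show False using p(1) pv by simp
    qed
    have "k * (k * q l1 l2 l3) = k * (D * p1 * l1 + D * p2 * l2 + D * p3 * l3)"
      unfolding 1 2 3 q_def by (simp add: algebra_simps power2_eq_square)
    also have "\<dots> = D * (p1 * (k * l1) + p2 * (k * l2) + p3 * (k * l3))"
      by (simp add: algebra_simps)
    also have "\<dots> = 0"
      using p(2) unfolding points k[symmetric] by (simp add: pv)
    finally show "q l1 l2 l3 = 0" using k0 by simp
  next
    assume q0: "q l1 l2 l3 = 0"
    define p1 p2 p3 where "p1 = (B * C - H\<^sup>2) * l1 + (G * H - C * F) * l2 + (F * H - B * G) * l3"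
      and "p2 = (G * H - C * F) * l1 + (A * C - G\<^sup>2) * l2 + (F * G - A * H) * l3"
      and "p3 = (F * H - B * G) * l1 + (F * G - A * H) * l2 + (A * B - F\<^sup>2) * l3"
    have eqs: "A * p1 + F * p2 + G * p3 = D * l1" "F * p1 + B * p2 + H * p3 = D * l2"
      "G * p1 + H * p2 + C * p3 = D * l3"
      by (simp_all add: p1_def p2_def p3_def D_def algebra_simps power2_eq_square)
    have "p1 * l1 + p2 * l2 + p3 * l3 = q l1 l2 l3"
      by (simp add: p1_def p2_def p3_def q_def algebra_simps power2_eq_square)
    then have pl: "p1 * l1 + p2 * l2 + p3 * l3 = 0" using q0 by simp
    have "p1 * (D * l1) + p2 * (D * l2) + p3 * (D * l3) = D * (p1 * l1 + p2 * l2 + p3 * l3)"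
      by (simp add: algebra_simps)
    then have "vector [p1, p2, p3] \<in> conic_points (qform_matrix a b c f g h)"
      using pl by (simp add: points eqs)
    moreover have "(vector [p1, p2, p3] :: 'a alg_closure^3) \<noteq> 0"
      using eqs l D by (auto simp: mult_eq_0_iff)
    moreover have "map_matrix to_ac (qform_matrix a b c f g h) *v vector [p1, p2, p3]
        = D *s vector [l1, l2, l3]"
      unfolding Mp by (simp add: eqs vec_eq_iff forall_3)
    then have "line_of (vector [l1, l2, l3])
       = line_of (map_matrix to_ac (qform_matrix a b c f g h) *v vector [p1, p2, p3])"
      using D by (simp add: line_of_scale)
    ultimately show "tangent_to (line_of (vector [l1, l2, l3])) (qform_matrix a b c f g h)"
      unfolding tangent_to_def by blast
  qed
qed

section \<open>Nonsquares and irreducible polynomials\<close>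

text \<open>
  Squaring is two-to-one on the nonzero elements, so there are as many nonzero squares as nonsquares.
  Multiplication by a nonsquare \<open>m\<close> maps the former injectively into the latter, hence onto.
\<close>

lemma is_square_mult_nonsquares:
  fixes m n :: "'a::{field,finite}"
  assumes two: "(2::'a) \<noteq> 0" and m: "\<not> is_square m" and n: "\<not> is_square n"
  shows "is_square (m * n)"
proof -
  define N where "N = - {0::'a}"
  define Sq where "Sq = (\<lambda>x::'a. x\<^sup>2) ` N"
  have fibre: "card {x \<in> N. x\<^sup>2 = y} = 2" if "y \<in> Sq" for y
  proof -
    obtain x where x: "x \<noteq> 0" "y = x\<^sup>2" using \<open>y \<in> Sq\<close> by (auto simp: Sq_def N_def)
    then have "{x \<in> N. x\<^sup>2 = y} = {x, - x}" by (auto simp: N_def power2_eq_iff)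
    moreover have "x \<noteq> - x" using x(1) two by (simp add: eq_neg_iff_add_eq_0 flip: mult_2)
    ultimately show ?thesis by simp
  qed
  have "N = (\<Union>y\<in>Sq. {x \<in> N. x\<^sup>2 = y})" by (auto simp: Sq_def)
  then have "card N = card (\<Union>y\<in>Sq. {x \<in> N. x\<^sup>2 = y})" by simp
  also have "\<dots> = (\<Sum>y\<in>Sq. card {x \<in> N. x\<^sup>2 = y})"
    by (rule card_UN_disjoint) auto
  also have "\<dots> = 2 * card Sq" using fibre by simp
  finally have cX: "card N = 2 * card Sq" .
  have m0: "m \<noteq> 0" and n0: "n \<noteq> 0" using m n by auto
  have SqX: "Sq \<subseteq> N" by (auto simp: Sq_def N_def)
  have sub: "(*) m ` Sq \<subseteq> N - Sq"
  proof -
    have False if "x \<noteq> 0" "y \<noteq> 0" "m * x\<^sup>2 = y\<^sup>2" for x y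
    proof -
      have "m = (y / x)\<^sup>2" using that by (simp add: power_divide field_simps)
      then show False using m by (metis is_nth_powerI)
    qed
    then show ?thesis using m0 by (auto simp: Sq_def N_def)
  qed
  have "card ((*) m ` Sq) = card (N - Sq)"
    using cX SqX m0 by (simp add: card_image inj_on_def card_Diff_subset)
  then have "(*) m ` Sq = N - Sq" using sub by (intro card_subset_eq) simp_all
  moreover have "n \<in> N - Sq" using n n0 by (auto simp: N_def Sq_def)
  ultimately have "n \<in> (*) m ` Sq" by simp
  then obtain x where "n = m * x\<^sup>2" by (auto simp: Sq_def)
  then have "m * n = (m * x)\<^sup>2" by (simp add: power2_eq_square algebra_simps)
  then show ?thesis by (metis is_nth_powerI)
qed

lemma irreducible_imp_nonsquare_disc:
  fixes e :: "'a::field"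
  assumes "(2::'a) \<noteq> 0" "irreducible [:e, 1, 1:]"
  shows "\<not> is_square (1 - 4 * e)"
proof
  assume "is_square (1 - 4 * e)"
  then obtain w where w: "1 - 4 * e = w\<^sup>2" by (auto elim: is_nth_powerE)
  define t where "t = (w - 1) / 2"
  have t: "w = 2 * t + 1" 
    using assms(1) unfolding t_def
    by (metis diff_add_cancel nonzero_mult_div_cancel_left times_divide_eq_right)
  have "4 * (e + t + t\<^sup>2) = w\<^sup>2 - (1 - 4 * e)"
    unfolding t by (simp add: algebra_simps power2_eq_square)
  then have "4 * (e + t + t\<^sup>2) = 0" using w by simp
  then have "e + t + t\<^sup>2 = 0" using four_neq_zero[OF assms(1)] by (metis mult_eq_0_iff)
  then have "poly [:e, 1, 1:] t = 0" by (simp add: power2_eq_square algebra_simps)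
  then show False using root_imp_reducible_poly[of "[:e, 1, 1:]" t] assms(2) by simp
qed

lemma irreducible_imp_disc_form_anisotropic:
  fixes b c :: "'a::field"
  assumes "irreducible [:1, c, b, 1:]" "k \<noteq> 0"
    and "disc_form k (k * b) (k * c) k u v = 0"
  shows "u = 0 \<and> v = 0"
proof -
  have "k * (u ^ 3 + b * u\<^sup>2 * v + c * u * v\<^sup>2 + v ^ 3) = 0"
    using assms(3) by (simp add: disc_form_def algebra_simps)
  then have z: "u ^ 3 + b * u\<^sup>2 * v + c * u * v\<^sup>2 + v ^ 3 = 0" using assms(2) by simp
  have "v = 0"
  proof (rule ccontr)
    assume v: "v \<noteq> 0"
    define t where "t = u / v"
    have u: "u = t * v" using v by (simp add: t_def)
    have "v ^ 3 * poly [:1, c, b, 1:] t = u ^ 3 + b * u\<^sup>2 * v + c * u * v\<^sup>2 + v ^ 3"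
      unfolding u by (simp add: algebra_simps eval_nat_numeral)
    then have "poly [:1, c, b, 1:] t = 0" using z v by simp
    then show False using root_imp_reducible_poly[of "[:1, c, b, 1:]" t] assms(1) by simp
  qed
  then show ?thesis using z by simp
qed

lemma exists_complementary_factors:
  assumes "(2::'a::alg_closed_field) \<noteq> 0"
  shows "\<exists>a::'a. a * (1 - a) = x"
proof -
  obtain w where w: "w\<^sup>2 = 1 - 4 * x" using nth_root_exists[of 2 "1 - 4 * x"] by auto
  define a where "a = (1 + w) / 2"
  have w': "w = 2 * a - 1"
    using assms unfolding a_def
    by (metis add_diff_cancel_left' nonzero_mult_div_cancel_left times_divide_eq_right)
  have "4 * (a * (1 - a)) = 1 - (2 * a - 1)\<^sup>2" by (simp add: algebra_simps power2_eq_square)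
  also have "\<dots> = 4 * x" using w by (simp flip: w')
  finally have "4 * (a * (1 - a)) = 4 * x" .
  then have "a * (1 - a) = x" using four_neq_zero[OF assms] by simp
  then show ?thesis by blast
qed

lemma two_alg_closure_neq_zero: "(2::'a::field) \<noteq> 0 \<Longrightarrow> (2::'a alg_closure) \<noteq> 0"
  by (metis to_ac_eq_0_iff to_ac_numeral)

text \<open>
  The roots of \<open>T\<^sup>2 - T + e\<close> are \<open>a\<close> and \<open>1 - a\<close>, so \<open>y\<^sup>2 + y z + e z\<^sup>2 = (y + a z) (y + (1 - a) z)\<close>.
  The factors differ because the discriminant \<open>1 - 4 e\<close> is not zero.
\<close>

lemma conjugate_factors:
  fixes e :: "'a::field"
  assumes two: "(2::'a) \<noteq> 0" and e: "1 - 4 * e \<noteq> 0"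
  obtains a where "to_ac e = a * (1 - a)" "a \<noteq> 1 - a"
proof -
  have two': "(2::'a alg_closure) \<noteq> 0" using two by (metis to_ac_eq_0_iff to_ac_numeral)
  obtain a where a: "to_ac e = a * (1 - a)"
    using exists_complementary_factors[OF two', of "to_ac e"] by metis
  have "a \<noteq> 1 - a"
  proof
    assume eq: "a = 1 - a"
    have "(2 * a - 1)\<^sup>2 = 1 - 4 * (a * (1 - a))" by (simp add: algebra_simps power2_eq_square)
    also have "\<dots> = to_ac (1 - 4 * e)" by (simp add: a)
    finally have "(2 * a - 1)\<^sup>2 \<noteq> 0" using e by (simp only: to_ac_eq_0_iff not_False_eq_True)
    moreover have "2 * a - 1 = a - (1 - a)" by simp
    moreover have "a - (1 - a) = 0" by (rule right_minus_eq[THEN iffD2, OF eq])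
    ultimately show False by simp
  qed
  with a show ?thesis by (rule that)
qed

section \<open>Singular conics in valid pairs\<close>

lemma smooth_conic_qform_matrix:
  assumes "(2::'a::field) \<noteq> 0"
  shows "smooth_conic (qform_matrix a b c f g h :: 'a^3^3) \<longleftrightarrow> qform_disc a b c f g h \<noteq> 0"
  using det_qform_matrix[OF assms, of a b c f g h] four_neq_zero[OF assms]
  by (simp add: smooth_conic_def invertible_det_nz flip: det_qform_matrix[OF assms])

lemma pencil_conic_qform_matrix:
  "pencil_conic (qform_matrix a b c f g h, qform_matrix a' b' c' f' g' h') r
    = qform_matrix (pnum r * a + pden r * a') (pnum r * b + pden r * b') (pnum r * c + pden r * c')
        (pnum r * f + pden r * f') (pnum r * g + pden r * g') (pnum r * h + pden r * h')"
  by (simp add: vec_eq_iff forall_3 pencil_conic_nth qform_matrix_def add_divide_distrib)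

text \<open>
  The mixed determinants are obtained by polarizing \<open>qform_disc\<close>.
\<close>

lemma has_disc_qform_matrixI:
  fixes a :: "'a::field"
  assumes two: "(2::'a) \<noteq> 0"
    and k0: "4 * k0 = qform_disc a b c f g h"
    and k1: "4 * k1 = a' * (4 * b * c - h\<^sup>2) + b' * (4 * a * c - g\<^sup>2) + c' * (4 * a * b - f\<^sup>2)
      + f' * (g * h - 2 * c * f) + g' * (f * h - 2 * b * g) + h' * (f * g - 2 * a * h)"
    and k2: "4 * k2 = a * (4 * b' * c' - h'\<^sup>2) + b * (4 * a' * c' - g'\<^sup>2) + c * (4 * a' * b' - f'\<^sup>2)
      + f * (g' * h' - 2 * c' * f') + g * (f' * h' - 2 * b' * g') + h * (f' * g' - 2 * a' * h')"
    and k3: "4 * k3 = qform_disc a' b' c' f' g' h'"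
  shows "has_disc (qform_matrix a b c f g h, qform_matrix a' b' c' f' g' h') k0 k1 k2 k3"
proof -
  have mixed2: "4 * mixed_det (qform_matrix a b c (2 * f) (2 * g) (2 * h)) (qform_matrix a' b' c' (2 * f') (2 * g') (2 * h'))
    = a * (4 * b' * c' - (2 * h')\<^sup>2) + b * (4 * a' * c' - (2 * g')\<^sup>2) + c * (4 * a' * b' - (2 * f')\<^sup>2)
      + 2 * f * (2 * g' * (2 * h') - 2 * c' * (2 * f')) + 2 * g * (2 * f' * (2 * h') - 2 * b' * (2 * g'))
      + 2 * h * (2 * f' * (2 * g') - 2 * a' * (2 * h'))" for a b c f g h a' b' c' f' g' h' :: 'a
    unfolding qform_matrix_double[OF two] mixed_det_def
    by (simp add: algebra_simps power2_eq_square)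
  have mixed: "4 * mixed_det (qform_matrix a b c f g h) (qform_matrix a' b' c' f' g' h')
    = a * (4 * b' * c' - h'\<^sup>2) + b * (4 * a' * c' - g'\<^sup>2) + c * (4 * a' * b' - f'\<^sup>2)
      + f * (g' * h' - 2 * c' * f') + g * (f' * h' - 2 * b' * g') + h * (f' * g' - 2 * a' * h')"
    for a b c f g h a' b' c' f' g' h' :: 'a
    using mixed2[of a b c "f / 2" "g / 2" "h / 2" a' b' c' "f' / 2" "g' / 2" "h' / 2"] two by simp
  have "4 * x = 4 * y \<Longrightarrow> x = y" for x y :: 'a using four_neq_zero[OF two] by simp
  then show ?thesis
    unfolding has_disc_def fst_conv snd_conv
    using det_qform_matrix[OF two] mixed k0 k1 k2 k3 by metis
qed

text \<open>
  One entry of \<open>C\<^sub>r\<close> is a multiple of \<open>pnum r\<close> only, another one of \<open>pden r\<close> only, so proportional matrices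
  have proportional parameters.
\<close>

lemma same_conic_pencil:
  assumes "G $ i $ j \<noteq> 0" "H $ i $ j = 0" "H $ k $ l \<noteq> 0" "G $ k $ l = 0"
  shows "same_conic (pencil_conic (G, H) r) (pencil_conic (G, H) s) \<longleftrightarrow> r = s"
proof
  assume "same_conic (pencil_conic (G, H) r) (pencil_conic (G, H) s)"
  then obtain t where "pencil_conic (G, H) r = map_matrix ((*) t) (pencil_conic (G, H) s)"
    by (auto simp: same_conic_def)
  then have eq: "pnum r * G $ i $ j + pden r * H $ i $ j = t * (pnum s * G $ i $ j + pden s * H $ i $ j)"
    for i j by (metis nth_map_matrix pencil_conic_nth)
  have "pnum r = t * pnum s" "pden r = t * pden s"
    using eq[of i j] eq[of k l] assms by simp_all
  then have "s = r" by (rule param_eqI)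
  then show "r = s" by simp
next
  assume "r = s"
  then show "same_conic (pencil_conic (G, H) r) (pencil_conic (G, H) s)"
    by (auto simp: same_conic_def vec_eq_iff intro!: exI[of _ 1])
qed

text \<open>
  The condition under which a singular conic can be the first member of a valid pair.
\<close>

definition transversal_lines :: "'a::field^3^3 \<Rightarrow> 'a^3^3 \<Rightarrow> bool" where
  "transversal_lines A B \<longleftrightarrow> (\<exists>L M. is_line L \<and> is_line M \<and> L \<noteq> M \<and> conic_points A = L \<union> M \<and>
             \<not> tangent_to L B \<and> \<not> tangent_to M B)"

lemma smooth_pairs_eq:
  assumes "\<And>r s. same_conic (pencil_conic P r) (pencil_conic P s) \<longleftrightarrow> r = s"
    and "\<And>r. smooth_conic (pencil_conic P r) \<longleftrightarrow> r \<in> S"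
  shows "smooth_pairs P = distinct_pairs S S"
  using assms by (auto simp: smooth_pairs_def smooth_pair_def distinct_pairs_def)

lemma valid_pairs_eq:
  assumes "\<And>r s. same_conic (pencil_conic P r) (pencil_conic P s) \<longleftrightarrow> r = s"
    and "\<And>r. smooth_conic (pencil_conic P r) \<longleftrightarrow> r \<in> S"
    and "\<And>r s. r \<notin> S \<Longrightarrow> s \<in> S \<Longrightarrow>
      transversal_lines (pencil_conic P r) (pencil_conic P s) \<longleftrightarrow> r \<in> R"
    and "S \<subseteq> R"
  shows "valid_pairs P = distinct_pairs R S"
proof -
  have "valid_pair (pencil_conic P r) (pencil_conic P s) \<longleftrightarrow> r \<in> R \<and> s \<in> S \<and> r \<noteq> s" for r s
    unfolding valid_pair_def assms(1,2) transversal_lines_def[symmetric] using assms(3,4) by blast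
  then show ?thesis by (simp add: valid_pairs_def distinct_pairs_def)
qed

lemma is_line_vector:
  "l1 \<noteq> 0 \<or> l2 \<noteq> 0 \<or> l3 \<noteq> 0 \<Longrightarrow> is_line (line_of (vector [l1, l2, l3]))"
  unfolding is_line_def by (rule exI[of _ "vector [l1, l2, l3]"]) auto

lemma transversal_linesI:
  fixes a b c f g h :: "'a::field"
  assumes two: "(2::'a) \<noteq> 0"
    and factors: "to_ac a = la * ma" "to_ac b = lb * mb" "to_ac c = lc * mc"
      "to_ac f = la * mb + lb * ma" "to_ac g = la * mc + lc * ma" "to_ac h = lb * mc + lc * mb"
    and lines_neq: "la * mb \<noteq> lb * ma \<or> la * mc \<noteq> lc * ma \<or> lb * mc \<noteq> lc * mb"
    and disc: "qform_disc a' b' c' f' g' h' \<noteq> 0"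
    and l: "dual_qform (to_ac a') (to_ac b') (to_ac c') (to_ac f') (to_ac g') (to_ac h') la lb lc \<noteq> 0"
    and m: "dual_qform (to_ac a') (to_ac b') (to_ac c') (to_ac f') (to_ac g') (to_ac h') ma mb mc \<noteq> 0"
  shows "transversal_lines (qform_matrix a b c f g h) (qform_matrix a' b' c' f' g' h')"
proof -
  have nz: "la \<noteq> 0 \<or> lb \<noteq> 0 \<or> lc \<noteq> 0" "ma \<noteq> 0 \<or> mb \<noteq> 0 \<or> mc \<noteq> 0" using lines_neq by auto
  have neq: "line_of (vector [la, lb, lc]) \<noteq> line_of (vector [ma, mb, mc])"
  proof
    assume "line_of (vector [la, lb, lc]) = line_of (vector [ma, mb, mc])"
    then have "\<exists>k. (vector [ma, mb, mc] :: 'a alg_closure^3) = k *s vector [la, lb, lc]"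
      using line_of_subsetD[of "vector [la, lb, lc]" "vector [ma, mb, mc]"] nz by simp
    then show False using lines_neq by (auto simp: vec_eq_iff forall_3)
  qed
  show ?thesis
    unfolding transversal_lines_def conic_points_line_pair[OF two factors]
    using is_line_vector[OF nz(1)] is_line_vector[OF nz(2)] neq
      tangent_to_iff[OF two disc nz(1)] tangent_to_iff[OF two disc nz(2)] l m by blast
qed

lemma not_transversal_lines_tangent:
  fixes a b c f g h :: "'a::field"
  assumes two: "(2::'a) \<noteq> 0"
    and factors: "to_ac a = la * ma" "to_ac b = lb * mb" "to_ac c = lc * mc"
      "to_ac f = la * mb + lb * ma" "to_ac g = la * mc + lc * ma" "to_ac h = lb * mc + lc * mb"
    and nz: "la \<noteq> 0 \<or> lb \<noteq> 0 \<or> lc \<noteq> 0"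
    and disc: "qform_disc a' b' c' f' g' h' \<noteq> 0"
    and l: "dual_qform (to_ac a') (to_ac b') (to_ac c') (to_ac f') (to_ac g') (to_ac h') la lb lc = 0"
  shows "\<not> transversal_lines (qform_matrix a b c f g h) (qform_matrix a' b' c' f' g' h')"
proof
  assume "transversal_lines (qform_matrix a b c f g h) (qform_matrix a' b' c' f' g' h')"
  then obtain L M where LM: "is_line L" "is_line M"
    "line_of (vector [la, lb, lc]) \<union> line_of (vector [ma, mb, mc]) = L \<union> M"
    "\<not> tangent_to L (qform_matrix a' b' c' f' g' h')" "\<not> tangent_to M (qform_matrix a' b' c' f' g' h')"
    unfolding transversal_lines_def conic_points_line_pair[OF two factors] by blast
  have "line_of (vector [la, lb, lc]) = L \<or> line_of (vector [la, lb, lc]) = M"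
    using line_subset_union_lines[OF is_line_vector[OF nz] LM(1,2)] LM(3) by blast
  then show False using LM(4,5) tangent_to_iff[OF two disc nz] l by blast
qed

lemma not_transversal_lines_double:
  fixes a b c f g h :: "'a::field"
  assumes two: "(2::'a) \<noteq> 0"
    and factors: "to_ac a = la * la" "to_ac b = lb * lb" "to_ac c = lc * lc"
      "to_ac f = la * lb + lb * la" "to_ac g = la * lc + lc * la" "to_ac h = lb * lc + lc * lb"
    and nz: "la \<noteq> 0 \<or> lb \<noteq> 0 \<or> lc \<noteq> 0"
  shows "\<not> transversal_lines (qform_matrix a b c f g h) B"
proof
  assume "transversal_lines (qform_matrix a b c f g h) B"
  then obtain L M where LM: "is_line L" "is_line M" "L \<noteq> M"
    "line_of (vector [la, lb, lc]) = L \<union> M"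
    unfolding transversal_lines_def conic_points_line_pair[OF two factors] by auto
  have "L = line_of (vector [la, lb, lc])" "M = line_of (vector [la, lb, lc])"
    using line_subset_union_lines[OF LM(1) is_line_vector[OF nz] is_line_vector[OF nz]]
      line_subset_union_lines[OF LM(2) is_line_vector[OF nz] is_line_vector[OF nz]] LM(4) by blast+
  then show False using LM(3) by simp
qed

section \<open>The eleven pencils\<close>

lemma minus_quarter_exists:
  assumes "(2::'a::field) \<noteq> 0"
  obtains \<kappa> :: "'a::field" where "4 * \<kappa> = - 1" "\<kappa> \<noteq> 0"
proof
  show "4 * (- 1 / 4 :: 'a) = - 1" "(- 1 / 4 :: 'a) \<noteq> 0" using four_neq_zero[OF assms] by simp_all
qed

lemma card_Some_image: "card (Some ` A) = card A" by (simp add: card_image)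

lemma card_Some_nonzero: "card (Some ` (- {0::'a::{field,finite}})) = CARD('a) - 1"
  by (simp add: card_Some_image Compl_eq_Diff_UNIV)

text \<open>
  Of the two singular conics, \<open>x y\<close> contains the line \<open>x = 0\<close>, which is tangent to all smooth conics of the pencil at
  the base point \<open>(0 : 1 : 0)\<close>. The lines of \<open>z (x + z)\<close> pass through two base points each, so they are
  tangent to none of them.
\<close>

lemma pencil4_prob:
  assumes two: "(2::'a::{field,finite}) \<noteq> 0"
  defines "P \<equiv> pencil4 :: 'a pencil"
  shows "poncelet4_prob_is P (smooth_pairs P) (1 / (real CARD('a) - 2))"
    and "poncelet4_prob_is P (valid_pairs P) (1 / (real CARD('a) - 1))"
proof -
  obtain \<kappa> :: 'a where k: "4 * \<kappa> = - 1" "\<kappa> \<noteq> 0" using minus_quarter_exists[OF two] .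
  have disc: "has_disc P 0 \<kappa> 0 0"
    unfolding P_def pencil4_def
    by (intro has_disc_qform_matrixI[OF two]) (simp_all add: qform_disc_def k)
  let ?S = "Some ` (- {0}) :: 'a option set"
  have conic: "pencil_conic P r = qform_matrix 0 0 (pden r) (pnum r) (pden r) 0" for r
    by (simp add: P_def pencil4_def pencil_conic_qform_matrix)
  have smooth: "smooth_conic (pencil_conic P r) \<longleftrightarrow> r \<in> ?S" for r
    by (cases r) (auto simp: smooth_pencil_conic[OF disc] disc_form_def k)
  have same: "same_conic (pencil_conic P r) (pencil_conic P s) \<longleftrightarrow> r = s" for r s
    unfolding P_def pencil4_def
    by (rule same_conic_pencil[of _ 1 2 _ 3 3]) (use two in \<open>simp_all add: qform_matrix_def\<close>)
  have trans: "transversal_lines (pencil_conic P r) (pencil_conic P s) \<longleftrightarrow> r \<in> range Some"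
    if r: "r \<notin> ?S" and s: "s \<in> ?S" for r s
  proof -
    obtain x where x: "s = Some x" "x \<noteq> 0" using s by auto
    have disc_x: "qform_disc 0 0 1 x 1 0 \<noteq> 0" using x by (simp add: qform_disc_def)
    show ?thesis
    proof (cases r)
      case None
      have "\<not> transversal_lines (qform_matrix 0 0 0 1 0 0) (qform_matrix 0 0 1 x 1 0)"
        by (rule not_transversal_lines_tangent[OF two _ _ _ _ _ _ _ disc_x,
              where la = 1 and lb = 0 and lc = 0 and ma = 0 and mb = 1 and mc = 0])
           (simp_all add: dual_qform_def)
      then show ?thesis by (simp add: conic x None)
    next
      case (Some y)
      then have "y = 0" using r by auto
      have "transversal_lines (qform_matrix 0 0 1 0 1 0) (qform_matrix 0 0 1 x 1 0)"
        by (rule transversal_linesI[OF two _ _ _ _ _ _ _ disc_x,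
              where la = 0 and lb = 0 and lc = 1 and ma = 1 and mb = 0 and mc = 1])
           (use x in \<open>simp_all add: dual_qform_def\<close>)
      then show ?thesis by (simp add: conic x Some \<open>y = 0\<close>)
    qed
  qed
  have valid: "valid_pairs P = distinct_pairs (range Some) ?S"
    by (rule valid_pairs_eq[OF same smooth trans]) auto
  show "poncelet4_prob_is P (smooth_pairs P) (1 / (real CARD('a) - 2))"
    using poncelet4_prob_double_root_zero[OF two disc k(2), of ?S] card_field_ge_3[OF two]
    unfolding smooth_pairs_eq[OF same smooth] by (auto simp: card_Some_nonzero of_nat_diff)
  show "poncelet4_prob_is P (valid_pairs P) (1 / (real CARD('a) - 1))"
    using poncelet4_prob_double_root_zero[OF two disc k(2), of "range Some"] card_field_ge_3[OF two]
    unfolding valid by (auto simp: card_Some_image)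
qed

text \<open>
  For \<open>r = 0\<close> the conic is \<open>(y + a z) (y + (1 - a) z)\<close> in the notation of \<open>conjugate_factors\<close>. For
  \<open>r = \<infinity>\<close> it is \<open>x y\<close>, whose line \<open>y = 0\<close> is tangent to all smooth conics of the pencil.
\<close>

lemma pencil15_prob:
  fixes e :: "'a::{field,finite}"
  assumes two: "(2::'a::{field,finite}) \<noteq> 0" and e: "e \<noteq> 0" "1 - 4 * e \<noteq> 0"
  defines "P \<equiv> pencil15 e"
  shows "poncelet4_prob_is P (smooth_pairs P) (1 / (real CARD('a) - 2))"
    and "poncelet4_prob_is P (valid_pairs P) (1 / (real CARD('a) - 1))"
proof -
  note two' = two_alg_closure_neq_zero[OF two]
  obtain \<kappa>' :: 'a where k': "4 * \<kappa>' = - 1" "\<kappa>' \<noteq> 0" using minus_quarter_exists[OF two] .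
  define \<kappa> where "\<kappa> = \<kappa>' * e"
  have k: "4 * \<kappa> = - e" "\<kappa> \<noteq> 0"
    using k' e by (simp_all add: \<kappa>_def flip: mult.assoc)
  have disc: "has_disc P 0 \<kappa> 0 0"
    unfolding P_def pencil15_def
    by (intro has_disc_qform_matrixI[OF two]) (simp_all add: qform_disc_def k)
  let ?S = "Some ` (- {0}) :: 'a option set"
  have conic: "pencil_conic P r = qform_matrix 0 (pden r) (pden r * e) (pnum r) 0 (pden r)" for r
    by (simp add: P_def pencil15_def pencil_conic_qform_matrix)
  have smooth: "smooth_conic (pencil_conic P r) \<longleftrightarrow> r \<in> ?S" for r
    by (cases r) (auto simp: smooth_pencil_conic[OF disc] disc_form_def k)
  have same: "same_conic (pencil_conic P r) (pencil_conic P s) \<longleftrightarrow> r = s" for r s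
    unfolding P_def pencil15_def
    by (rule same_conic_pencil[of _ 1 2 _ 2 2]) (use two in \<open>simp_all add: qform_matrix_def\<close>)
  have trans: "transversal_lines (pencil_conic P r) (pencil_conic P s) \<longleftrightarrow> r \<in> range Some"
    if r: "r \<notin> ?S" and s: "s \<in> ?S" for r s
  proof -
    obtain x where x: "s = Some x" "x \<noteq> 0" using s by auto
    have disc_x: "qform_disc 0 1 e x 0 1 \<noteq> 0" using x e by (simp add: qform_disc_def)
    show ?thesis
    proof (cases r)
      case None
      have "\<not> transversal_lines (qform_matrix 0 0 0 1 0 0) (qform_matrix 0 1 e x 0 1)"
        by (rule not_transversal_lines_tangent[OF two _ _ _ _ _ _ _ disc_x,
              where la = 0 and lb = 1 and lc = 0 and ma = 1 and mb = 0 and mc = 0])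
           (simp_all add: dual_qform_def)
      then show ?thesis by (simp add: conic x None)
    next
      case (Some y)
      then have "y = 0" using r by auto
      obtain a where a: "to_ac e = a * (1 - a)" and a2: "a \<noteq> 1 - a"
        using conjugate_factors[OF two e(2)] .
      have a01: "a \<noteq> 0" "1 - a \<noteq> 0" using a e(1) by (metis mult_zero_left mult_zero_right to_ac_eq_0_iff)+
      have "transversal_lines (qform_matrix 0 1 e 0 0 1) (qform_matrix 0 1 e x 0 1)"
        by (rule transversal_linesI[OF two _ _ _ _ _ _ _ disc_x,
              where la = 0 and lb = 1 and lc = a and ma = 0 and mb = 1 and mc = "1 - a"])
           (use x a a2 a01 in \<open>simp_all add: dual_qform_def eq_commute[of _ a]\<close>)
      then show ?thesis by (simp add: conic x Some \<open>y = 0\<close>)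
    qed
  qed
  have valid: "valid_pairs P = distinct_pairs (range Some) ?S"
    by (rule valid_pairs_eq[OF same smooth trans]) auto
  show "poncelet4_prob_is P (smooth_pairs P) (1 / (real CARD('a) - 2))"
    using poncelet4_prob_double_root_zero[OF two disc k(2), of ?S] card_field_ge_3[OF two]
    unfolding smooth_pairs_eq[OF same smooth] by (auto simp: card_Some_nonzero of_nat_diff)
  show "poncelet4_prob_is P (valid_pairs P) (1 / (real CARD('a) - 1))"
    using poncelet4_prob_double_root_zero[OF two disc k(2), of "range Some"] card_field_ge_3[OF two]
    unfolding valid by (auto simp: card_Some_image)
qed

text \<open>
  All smooth conics of the pencil touch the line \<open>x = 0\<close>, a component of the only singular one.
\<close>

lemma pencil5_prob:
  assumes two: "(2::'a::{field,finite}) \<noteq> 0"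
  defines "P \<equiv> pencil5 :: 'a pencil"
  shows "poncelet4_prob_is P (smooth_pairs P) 0" and "poncelet4_prob_is P (valid_pairs P) 0"
proof -
  obtain \<kappa> :: 'a where k: "4 * \<kappa> = - 1" "\<kappa> \<noteq> 0" using minus_quarter_exists[OF two] .
  have disc: "has_disc P 0 0 0 \<kappa>"
    unfolding P_def pencil5_def
    by (intro has_disc_qform_matrixI[OF two]) (simp_all add: qform_disc_def k)
  let ?S = "range Some :: 'a option set"
  have conic: "pencil_conic P r = qform_matrix 0 (pden r) 0 (pnum r) (pden r) 0" for r
    by (simp add: P_def pencil5_def pencil_conic_qform_matrix)
  have smooth: "smooth_conic (pencil_conic P r) \<longleftrightarrow> r \<in> ?S" for r
    by (cases r) (auto simp: smooth_pencil_conic[OF disc] disc_form_def k)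
  have same: "same_conic (pencil_conic P r) (pencil_conic P s) \<longleftrightarrow> r = s" for r s
    unfolding P_def pencil5_def
    by (rule same_conic_pencil[of _ 1 2 _ 2 2]) (use two in \<open>simp_all add: qform_matrix_def\<close>)
  have trans: "transversal_lines (pencil_conic P r) (pencil_conic P s) \<longleftrightarrow> r \<in> ?S"
    if r: "r \<notin> ?S" and s: "s \<in> ?S" for r s
  proof -
    obtain x where x: "s = Some x" using s by auto
    have r: "r = None" using r by (cases r) auto
    have disc_x: "qform_disc 0 1 0 x 1 0 \<noteq> 0" by (simp add: qform_disc_def)
    have "\<not> transversal_lines (qform_matrix 0 0 0 1 0 0) (qform_matrix 0 1 0 x 1 0)"
      by (rule not_transversal_lines_tangent[OF two _ _ _ _ _ _ _ disc_x,
            where la = 1 and lb = 0 and lc = 0 and ma = 0 and mb = 1 and mc = 0])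
         (simp_all add: dual_qform_def)
    then show ?thesis by (simp add: conic x r image_iff)
  qed
  have valid: "valid_pairs P = distinct_pairs ?S ?S"
    by (rule valid_pairs_eq[OF same smooth trans]) auto
  show "poncelet4_prob_is P (smooth_pairs P) 0" "poncelet4_prob_is P (valid_pairs P) 0"
    using poncelet4_prob_triple_root[OF two disc k(2)] unfolding smooth_pairs_eq[OF same smooth] valid by auto
qed

lemma pencil8_prob:
  assumes two: "(2::'a::{field,finite}) \<noteq> 0"
  defines "P \<equiv> pencil8 :: 'a pencil"
  shows "poncelet4_prob_is P (smooth_pairs P) 0" and "poncelet4_prob_is P (valid_pairs P) 0"
proof -
  obtain \<kappa> :: 'a where k: "4 * \<kappa> = - 1" "\<kappa> \<noteq> 0" using minus_quarter_exists[OF two] .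
  have disc: "has_disc P 0 0 0 \<kappa>"
    unfolding P_def pencil8_def
    by (intro has_disc_qform_matrixI[OF two]) (simp_all add: qform_disc_def k)
  let ?S = "range Some :: 'a option set"
  have conic: "pencil_conic P r = qform_matrix (pnum r) 0 (pden r) (pden r) 0 0" for r
    by (simp add: P_def pencil8_def pencil_conic_qform_matrix)
  have smooth: "smooth_conic (pencil_conic P r) \<longleftrightarrow> r \<in> ?S" for r
    by (cases r) (auto simp: smooth_pencil_conic[OF disc] disc_form_def k)
  have same: "same_conic (pencil_conic P r) (pencil_conic P s) \<longleftrightarrow> r = s" for r s
    unfolding P_def pencil8_def
    by (rule same_conic_pencil[of _ 1 1 _ 3 3]) (use two in \<open>simp_all add: qform_matrix_def\<close>)
  have trans: "transversal_lines (pencil_conic P r) (pencil_conic P s) \<longleftrightarrow> r \<in> ?S"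
    if r: "r \<notin> ?S" and s: "s \<in> ?S" for r s
  proof -
    have r: "r = None" using r by (cases r) auto
    have "\<not> transversal_lines (qform_matrix 1 0 0 0 0 0) (pencil_conic P s)"
      by (rule not_transversal_lines_double[OF two, where la = 1 and lb = 0 and lc = 0]) simp_all
    then show ?thesis by (simp add: conic r image_iff)
  qed
  have valid: "valid_pairs P = distinct_pairs ?S ?S"
    by (rule valid_pairs_eq[OF same smooth trans]) auto
  show "poncelet4_prob_is P (smooth_pairs P) 0" "poncelet4_prob_is P (valid_pairs P) 0"
    using poncelet4_prob_triple_root[OF two disc k(2)] unfolding smooth_pairs_eq[OF same smooth] valid by auto
qed

text \<open>
  Both lines of \<open>x y\<close> are tangent to all smooth conics of the pencil, and \<open>z\<^sup>2\<close> is a double line. So all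
  valid pairs are smooth.
\<close>

lemma pencil6_prob:
  assumes two: "(2::'a::{field,finite}) \<noteq> 0"
  defines "P \<equiv> pencil6 :: 'a pencil"
  shows "poncelet4_prob_is P (smooth_pairs P) (1 / (real CARD('a) - 2))"
    and "poncelet4_prob_is P (valid_pairs P) (1 / (real CARD('a) - 2))"
proof -
  obtain \<kappa> :: 'a where k: "4 * \<kappa> = - 1" "\<kappa> \<noteq> 0" using minus_quarter_exists[OF two] .
  have disc: "has_disc P 0 \<kappa> 0 0"
    unfolding P_def pencil6_def
    by (intro has_disc_qform_matrixI[OF two]) (simp_all add: qform_disc_def k)
  let ?S = "Some ` (- {0}) :: 'a option set"
  have conic: "pencil_conic P r = qform_matrix 0 0 (pden r) (pnum r) 0 0" for r
    by (simp add: P_def pencil6_def pencil_conic_qform_matrix)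
  have smooth: "smooth_conic (pencil_conic P r) \<longleftrightarrow> r \<in> ?S" for r
    by (cases r) (auto simp: smooth_pencil_conic[OF disc] disc_form_def k)
  have same: "same_conic (pencil_conic P r) (pencil_conic P s) \<longleftrightarrow> r = s" for r s
    unfolding P_def pencil6_def
    by (rule same_conic_pencil[of _ 1 2 _ 3 3]) (use two in \<open>simp_all add: qform_matrix_def\<close>)
  have not_trans: "\<not> transversal_lines (pencil_conic P r) (pencil_conic P s)"
    if r: "r \<notin> ?S" and s: "s \<in> ?S" for r s
  proof -
    obtain x where x: "s = Some x" "x \<noteq> 0" using s by auto
    show ?thesis
    proof (cases r)
      case None
      have disc_x: "qform_disc 0 0 1 x 0 0 \<noteq> 0" using x by (simp add: qform_disc_def)
      have "\<not> transversal_lines (qform_matrix 0 0 0 1 0 0) (qform_matrix 0 0 1 x 0 0)"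
        by (rule not_transversal_lines_tangent[OF two _ _ _ _ _ _ _ disc_x,
              where la = 1 and lb = 0 and lc = 0 and ma = 0 and mb = 1 and mc = 0])
           (simp_all add: dual_qform_def)
      then show ?thesis by (simp add: conic x None)
    next
      case (Some y)
      then have "y = 0" using r by auto
      have "\<not> transversal_lines (qform_matrix 0 0 1 0 0 0) (pencil_conic P s)"
        by (rule not_transversal_lines_double[OF two, where la = 0 and lb = 0 and lc = 1]) simp_all
      then show ?thesis by (simp add: conic Some \<open>y = 0\<close>)
    qed
  qed
  have valid: "valid_pairs P = distinct_pairs ?S ?S"
    by (rule valid_pairs_eq[OF same smooth]) (use not_trans in blast)+
  show "poncelet4_prob_is P (smooth_pairs P) (1 / (real CARD('a) - 2))"
    "poncelet4_prob_is P (valid_pairs P) (1 / (real CARD('a) - 2))"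
    using poncelet4_prob_double_root_zero[OF two disc k(2), of ?S] card_field_ge_3[OF two]
    unfolding smooth_pairs_eq[OF same smooth] valid by (auto simp: card_Some_nonzero of_nat_diff)
qed

text \<open>
  The conic with parameter \<open>\<infinity>\<close> is a double line, and both lines of the conic with parameter \<open>0\<close> are tangent to
  all smooth conics of the pencil. So all valid pairs are smooth.
\<close>

lemma pencil17_prob:
  fixes e :: "'a::{field,finite}"
  assumes two: "(2::'a) \<noteq> 0" and e: "1 - 4 * e \<noteq> 0"
  defines "P \<equiv> pencil17 e"
  shows "poncelet4_prob_is P (smooth_pairs P) (1 / (real CARD('a) - 2))"
    and "poncelet4_prob_is P (valid_pairs P) (1 / (real CARD('a) - 2))"
proof -
  obtain \<kappa>' :: 'a where k': "4 * \<kappa>' = - 1" "\<kappa>' \<noteq> 0" using minus_quarter_exists[OF two] .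
  define \<kappa> where "\<kappa> = \<kappa>' * (1 - 4 * e)"
  have k: "4 * \<kappa> = - (1 - 4 * e)" "\<kappa> \<noteq> 0"
    unfolding \<kappa>_def mult.assoc[symmetric] k' using k' e by simp_all
  have disc: "has_disc P 0 0 \<kappa> 0"
    unfolding P_def pencil17_def
    by (intro has_disc_qform_matrixI[OF two]) (simp_all add: qform_disc_def k)
  let ?S = "Some ` (- {0}) :: 'a option set"
  have conic: "pencil_conic P r = qform_matrix (pnum r) (pden r) (pden r * e) 0 0 (pden r)" for r
    by (simp add: P_def pencil17_def pencil_conic_qform_matrix)
  have smooth: "smooth_conic (pencil_conic P r) \<longleftrightarrow> r \<in> ?S" for r
    by (cases r) (auto simp: smooth_pencil_conic[OF disc] disc_form_def k)
  have same: "same_conic (pencil_conic P r) (pencil_conic P s) \<longleftrightarrow> r = s" for r s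
    unfolding P_def pencil17_def
    by (rule same_conic_pencil[of _ 1 1 _ 2 2]) (use two in \<open>simp_all add: qform_matrix_def\<close>)
  have not_trans: "\<not> transversal_lines (pencil_conic P r) (pencil_conic P s)"
    if r: "r \<notin> ?S" and s: "s \<in> ?S" for r s
  proof -
    obtain x where x: "s = Some x" "x \<noteq> 0" using s by auto
    show ?thesis
    proof (cases r)
      case None
      have "\<not> transversal_lines (qform_matrix 1 0 0 0 0 0) (pencil_conic P s)"
        by (rule not_transversal_lines_double[OF two, where la = 1 and lb = 0 and lc = 0]) simp_all
      then show ?thesis by (simp add: conic None)
    next
      case (Some y)
      then have "y = 0" using r by auto
      obtain a where a: "to_ac e = a * (1 - a)" using conjugate_factors[OF two e] .
      have "qform_disc x 1 e 0 0 1 = - (x * (1 - 4 * e))" by (simp add: qform_disc_def algebra_simps)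
      then have disc_x: "qform_disc x 1 e 0 0 1 \<noteq> 0" using x e by simp
      have "\<not> transversal_lines (qform_matrix 0 1 e 0 0 1) (qform_matrix x 1 e 0 0 1)"
        by (rule not_transversal_lines_tangent[OF two _ _ _ _ _ _ _ disc_x,
              where la = 0 and lb = 1 and lc = a and ma = 0 and mb = 1 and mc = "1 - a"])
           (simp_all add: dual_qform_def a algebra_simps power2_eq_square)
      then show ?thesis by (simp add: conic x Some \<open>y = 0\<close>)
    qed
  qed
  have valid: "valid_pairs P = distinct_pairs ?S ?S"
    by (rule valid_pairs_eq[OF same smooth]) (use not_trans in blast)+
  show "poncelet4_prob_is P (smooth_pairs P) (1 / (real CARD('a) - 2))"
    "poncelet4_prob_is P (valid_pairs P) (1 / (real CARD('a) - 2))"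
    using poncelet4_prob_double_root_infinity[OF two disc k(2)]
    unfolding smooth_pairs_eq[OF same smooth] valid by auto
qed

text \<open>
  The only singular conic is \<open>x y\<close>, and each of its lines meets the other conics of the pencil in two
  different points.
\<close>

lemma pencil14_prob:
  fixes e :: "'a::{field,finite}"
  assumes two: "(2::'a) \<noteq> 0" and e: "\<not> is_square (1 - 4 * e)"
  defines "P \<equiv> pencil14 e"
  shows "poncelet4_prob_is P (smooth_pairs P) (1 / real CARD('a))"
    and "poncelet4_prob_is P (valid_pairs P) (1 / real CARD('a))"
proof -
  obtain \<kappa> :: 'a where k: "4 * \<kappa> = - 1" "\<kappa> \<noteq> 0" using minus_quarter_exists[OF two] .
  have k4: "4 * (\<kappa> * x) = - x" for x using k(1) by (metis mult.assoc mult_minus1)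
  have disc: "has_disc P 0 (\<kappa> * e) (\<kappa> * (- 1)) (\<kappa> * 1)"
    unfolding P_def pencil14_def
    by (intro has_disc_qform_matrixI[OF two]) (simp_all add: qform_disc_def k k4)
  have nsq: "\<not> is_square ((- 1)\<^sup>2 - 4 * e * 1)" using e by simp
  have e1: "4 * e \<noteq> 1" using e by auto
  let ?S = "range Some :: 'a option set"
  have conic: "pencil_conic P r = qform_matrix 0 (pden r) (pden r * e) (pnum r) (pden r) (pden r)" for r
    by (simp add: P_def pencil14_def pencil_conic_qform_matrix)
  have "disc_form 0 (\<kappa> * e) (\<kappa> * (- 1)) (\<kappa> * 1) x 1 \<noteq> 0" for x
  proof -
    have "disc_form 0 (\<kappa> * e) (\<kappa> * (- 1)) (\<kappa> * 1) x 1 = \<kappa> * (e * x\<^sup>2 + (- 1) * x * 1 + 1 * 1\<^sup>2)"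
      by (simp add: disc_form_def algebra_simps)
    then show ?thesis using nonsquare_disc_imp_anisotropic[OF two nsq, of x 1] k(2) by auto
  qed
  then have smooth: "smooth_conic (pencil_conic P r) \<longleftrightarrow> r \<in> ?S" for r
    unfolding smooth_pencil_conic[OF disc] by (cases r) (auto simp: disc_form_def)
  have same: "same_conic (pencil_conic P r) (pencil_conic P s) \<longleftrightarrow> r = s" for r s
    unfolding P_def pencil14_def
    by (rule same_conic_pencil[of _ 1 2 _ 2 2]) (use two in \<open>simp_all add: qform_matrix_def\<close>)
  have trans: "transversal_lines (pencil_conic P r) (pencil_conic P s)"
    if r: "r \<notin> ?S" and s: "s \<in> ?S" for r s
  proof -
    obtain x where x: "s = Some x" using s by auto
    have r: "r = None" using r by (cases r) auto
    have disc_x: "qform_disc 0 1 e x 1 1 \<noteq> 0"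
      using smooth[of s] s unfolding conic x smooth_conic_qform_matrix[OF two] by simp
    have "4 * to_ac e \<noteq> 1" using e1 by (metis to_ac_1 to_ac_eq_iff to_ac_mult to_ac_numeral)
    then have ne: "4 * to_ac e - 1 \<noteq> 0" by simp
    have "transversal_lines (qform_matrix 0 0 0 1 0 0) (qform_matrix 0 1 e x 1 1)"
      by (rule transversal_linesI[OF two _ _ _ _ _ _ _ disc_x,
            where la = 1 and lb = 0 and lc = 0 and ma = 0 and mb = 1 and mc = 0])
         (use ne in \<open>simp_all add: dual_qform_def\<close>)
    then show ?thesis by (simp add: conic x r)
  qed
  have valid: "valid_pairs P = distinct_pairs UNIV ?S"
    by (rule valid_pairs_eq[OF same smooth]) (use trans in auto)
  show "poncelet4_prob_is P (smooth_pairs P) (1 / real CARD('a))"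
    "poncelet4_prob_is P (valid_pairs P) (1 / real CARD('a))"
    using poncelet4_prob_one_root[OF two disc k(2) nsq]
    unfolding smooth_pairs_eq[OF same smooth] valid by auto
qed

text \<open>
  The only singular conic is \<open>x\<^sup>2 - \<nu> y\<^sup>2 = (x - w y) (x + w y)\<close> with \<open>w\<^sup>2 = \<nu>\<close>. Tangency of the line \<open>x + v y = 0\<close> with
  \<open>v\<^sup>2 = \<nu>\<close> would mean \<open>\<rho> = - 2 v \<sigma>\<close>, and then \<open>\<rho>\<^sup>2 - 4 \<nu> \<sigma>\<^sup>2\<close> would be zero.
\<close>

lemma pencil19_prob:
  fixes \<nu> \<rho> \<sigma> :: "'a::{field,finite}"
  assumes two: "(2::'a) \<noteq> 0" and nu: "\<not> is_square \<nu>"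
    and nsq: "\<not> is_square (\<rho>\<^sup>2 - 4 * \<nu> * \<sigma>\<^sup>2)"
  defines "P \<equiv> pencil19 \<nu> \<rho> \<sigma>"
  shows "poncelet4_prob_is P (smooth_pairs P) (1 / real CARD('a))"
    and "poncelet4_prob_is P (valid_pairs P) (1 / real CARD('a))"
proof -
  note two' = two_alg_closure_neq_zero[OF two]
  have nu0: "\<nu> \<noteq> 0" using nu by auto
  have disc: "has_disc P 0 ((- 1) * \<nu>) ((- 1) * \<rho>) ((- 1) * \<sigma>\<^sup>2)"
    unfolding P_def pencil19_def
    by (intro has_disc_qform_matrixI[OF two]) (simp_all add: qform_disc_def power2_eq_square algebra_simps)
  let ?S = "range Some :: 'a option set"
  have conic: "pencil_conic P r = qform_matrix (pnum r) (- (pnum r * \<nu>) - pden r * \<rho>) (pden r) (pden r * (2 * \<sigma>)) 0 0" for r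
    by (simp add: P_def pencil19_def pencil_conic_qform_matrix)
  have "disc_form 0 ((- 1) * \<nu>) ((- 1) * \<rho>) ((- 1) * \<sigma>\<^sup>2) x 1 \<noteq> 0" for x
  proof -
    have "disc_form 0 ((- 1) * \<nu>) ((- 1) * \<rho>) ((- 1) * \<sigma>\<^sup>2) x 1 = - (\<nu> * x\<^sup>2 + \<rho> * x * 1 + \<sigma>\<^sup>2 * 1\<^sup>2)"
      by (simp add: disc_form_def algebra_simps)
    then show ?thesis using nonsquare_disc_imp_anisotropic[OF two nsq, of x 1]
      by (metis neg_equal_0_iff_equal one_neq_zero)
  qed
  then have smooth: "smooth_conic (pencil_conic P r) \<longleftrightarrow> r \<in> ?S" for r
    unfolding smooth_pencil_conic[OF disc] by (cases r) (auto simp: disc_form_def)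
  have same: "same_conic (pencil_conic P r) (pencil_conic P s) \<longleftrightarrow> r = s" for r s
    unfolding P_def pencil19_def
    by (rule same_conic_pencil[of _ 1 1 _ 3 3]) (use two in \<open>simp_all add: qform_matrix_def\<close>)
  have trans: "transversal_lines (pencil_conic P r) (pencil_conic P s)"
    if r: "r \<notin> ?S" and s: "s \<in> ?S" for r s
  proof -
    obtain x where x: "s = Some x" using s by auto
    have r: "r = None" using r by (cases r) auto
    have disc_x: "qform_disc x (- (x * \<nu>) - \<rho>) 1 (2 * \<sigma>) 0 0 \<noteq> 0"
      using smooth[of s] s unfolding conic x smooth_conic_qform_matrix[OF two] by simp
    obtain w where w: "w\<^sup>2 = to_ac \<nu>" using nth_root_exists[of 2 "to_ac \<nu>"] by auto
    have w0: "w \<noteq> 0" using w nu0 by auto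
    have dual: "dual_qform (to_ac x) (to_ac (- (x * \<nu>) - \<rho>)) (to_ac 1) (to_ac (2 * \<sigma>)) (to_ac 0) (to_ac 0) 1 v 0 \<noteq> 0"
      if v: "v\<^sup>2 = to_ac \<nu>" for v
    proof
      assume "dual_qform (to_ac x) (to_ac (- (x * \<nu>) - \<rho>)) (to_ac 1) (to_ac (2 * \<sigma>)) (to_ac 0) (to_ac 0) 1 v 0 = 0"
      also have "dual_qform (to_ac x) (to_ac (- (x * \<nu>) - \<rho>)) (to_ac 1) (to_ac (2 * \<sigma>)) (to_ac 0) (to_ac 0) 1 v 0
         = - 4 * (to_ac \<rho> + 2 * v * to_ac \<sigma>)"
        by (simp add: dual_qform_def v algebra_simps)
      finally have "to_ac \<rho> + 2 * v * to_ac \<sigma> = 0"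
        using four_neq_zero[OF two'] by (metis mult_eq_0_iff neg_equal_0_iff_equal)
      then have "to_ac \<rho> = - (2 * v * to_ac \<sigma>)" by (simp add: eq_neg_iff_add_eq_0)
      then have "to_ac (\<rho>\<^sup>2) = (2 * v * to_ac \<sigma>)\<^sup>2" by simp
      also have "\<dots> = 4 * v\<^sup>2 * (to_ac \<sigma>)\<^sup>2" by (simp add: power_mult_distrib)
      also have "\<dots> = to_ac (4 * \<nu> * \<sigma>\<^sup>2)" by (simp add: v)
      finally have "\<rho>\<^sup>2 - 4 * \<nu> * \<sigma>\<^sup>2 = 0" unfolding to_ac_eq_iff by simp
      then show False using nsq by simp
    qed
    have ww: "- w \<noteq> w" using w0 two' by (metis add.inverse_inverse eq_neg_iff_add_eq_0 mult_2 mult_eq_0_iff)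
    have "transversal_lines (qform_matrix 1 (- \<nu>) 0 0 0 0) (qform_matrix x (- (x * \<nu>) - \<rho>) 1 (2 * \<sigma>) 0 0)"
      by (rule transversal_linesI[OF two _ _ _ _ _ _ _ disc_x,
            where la = 1 and lb = "- w" and lc = 0 and ma = 1 and mb = w and mc = 0])
         (use dual[of w] dual[of "- w"] w ww in \<open>auto simp: power2_eq_square\<close>)
    then show ?thesis by (simp add: conic x r)
  qed
  have valid: "valid_pairs P = distinct_pairs UNIV ?S"
    by (rule valid_pairs_eq[OF same smooth]) (use trans in auto)
  show "poncelet4_prob_is P (smooth_pairs P) (1 / real CARD('a))"
    "poncelet4_prob_is P (valid_pairs P) (1 / real CARD('a))"
    using poncelet4_prob_one_root[OF two disc _ nsq]
    unfolding smooth_pairs_eq[OF same smooth] valid by auto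
qed

lemma pencil18_prob:
  fixes b c :: "'a::{field,finite}"
  assumes two: "(2::'a) \<noteq> 0" and irred: "irreducible [:1, c, b, 1:]"
  defines "P \<equiv> pencil18 b c"
  shows "poncelet4_prob_is P (smooth_pairs P) 0"
    and "poncelet4_prob_is P (valid_pairs P) 0"
proof -
  obtain \<kappa> :: 'a where k: "4 * \<kappa> = - 1" "\<kappa> \<noteq> 0" using minus_quarter_exists[OF two] .
  have k4: "4 * (\<kappa> * x) = - x" for x using k(1) by (metis mult.assoc mult_minus1)
  have disc: "has_disc P \<kappa> (\<kappa> * b) (\<kappa> * c) \<kappa>"
    unfolding P_def pencil18_def
    by (intro has_disc_qform_matrixI[OF two]) (simp_all add: qform_disc_def k k4)
  note nz = irreducible_imp_disc_form_anisotropic[OF irred k(2)]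
  have smooth: "smooth_conic (pencil_conic P r) \<longleftrightarrow> r \<in> UNIV" for r
    unfolding smooth_pencil_conic[OF disc] using nz[of "pnum r" "pden r"] by (cases r) auto
  have same: "same_conic (pencil_conic P r) (pencil_conic P s) \<longleftrightarrow> r = s" for r s
    unfolding P_def pencil18_def
    by (rule same_conic_pencil[of _ 1 3 _ 1 1]) (use two in \<open>simp_all add: qform_matrix_def\<close>)
  have valid: "valid_pairs P = distinct_pairs UNIV UNIV"
    by (rule valid_pairs_eq[OF same smooth]) auto
  show "poncelet4_prob_is P (smooth_pairs P) 0" "poncelet4_prob_is P (valid_pairs P) 0"
    using poncelet4_prob_no_root[OF two disc nz] unfolding smooth_pairs_eq[OF same smooth] valid by auto
qed

text \<open>
  Up to a constant the discriminant is \<open>\<mu> (\<lambda>\<^sup>2 - \<lambda> \<mu> + (d + e - 4 d e) \<mu>\<^sup>2)\<close>, and the quadratic factor has the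
  discriminant \<open>(1 - 4 d) (1 - 4 e)\<close>; so it splits. With \<open>e = a (1 - a)\<close> and \<open>d = b (1 - b)\<close> the conic
  \<open>(a x + b y + z) ((1 - a) x + (1 - b) y + z)\<close> has the parameter \<open>a (1 - b) + b (1 - a)\<close>. Interchanging the
  roles of \<open>b\<close> and \<open>1 - b\<close> gives the other finite singular conic, so these two parameters are \<open>u\<close> and \<open>v\<close>.
  None of the lines of singular conics is tangent to a smooth conic of the pencil.
\<close>

lemma pencil16_pairs:
  fixes d e w :: "'a::{field,finite}"
  assumes two: "(2::'a) \<noteq> 0" and w: "(1 - 4 * d) * (1 - 4 * e) = w\<^sup>2" "w \<noteq> 0"
  obtains u v \<kappa> :: 'a where "u \<noteq> v" "\<kappa> \<noteq> 0"
    "has_disc (pencil16 d e) 0 \<kappa> (- \<kappa> * (u + v)) (\<kappa> * u * v)"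
    "smooth_pairs (pencil16 d e) = distinct_pairs (Some ` (- {u, v})) (Some ` (- {u, v}))"
    "valid_pairs (pencil16 d e) = distinct_pairs UNIV (Some ` (- {u, v}))"
proof -
  note four = four_neq_zero[OF two]
  note two' = two_alg_closure_neq_zero[OF two]
  note four' = four_neq_zero[OF two']
  have d1: "1 - 4 * d \<noteq> 0" and e1: "1 - 4 * e \<noteq> 0" using w by auto
  obtain \<kappa> :: 'a where k: "4 * \<kappa> = - 1" "\<kappa> \<noteq> 0" using minus_quarter_exists[OF two] .
  define u where "u = (1 + w) / 2"
  define v where "v = 1 - u"
  have u2: "2 * u = 1 + w" using two by (simp add: u_def)
  have uv: "u \<noteq> v"
  proof
    assume "u = v"
    then have "2 * u = 1" by (simp add: v_def)
    then show False using u2 w(2) by simp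
  qed
  have "4 * (u * v) = 2 * (2 * u) - (2 * u)\<^sup>2" by (simp add: v_def algebra_simps power2_eq_square)
  also have "\<dots> = 1 - (1 - 4 * d) * (1 - 4 * e)"
    unfolding u2 w(1) by (simp add: algebra_simps power2_eq_square)
  also have "\<dots> = 4 * (d + e - 4 * d * e)" by (simp add: algebra_simps)
  finally have prod: "u * v = d + e - 4 * d * e" using four by (metis mult_left_cancel)
  have sum: "u + v = 1" by (simp add: v_def)
  have disc: "has_disc (pencil16 d e) 0 \<kappa> (- \<kappa> * (u + v)) (\<kappa> * u * v)"
  proof -
    have "4 * (- \<kappa> * (u + v)) = 1" using k(1) by (simp add: sum)
    moreover have "4 * (\<kappa> * u * v) = - (d + e - 4 * d * e)"
      unfolding prod[symmetric] using k(1) by (metis mult.assoc mult_minus1)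
    ultimately show ?thesis
      unfolding pencil16_def
      by (intro has_disc_qform_matrixI[OF two])
         (simp_all add: qform_disc_def k(1) k(1)[unfolded mult.commute[of 4]] algebra_simps)
  qed
  let ?S = "Some ` (- {u, v})"
  have conic: "pencil_conic (pencil16 d e) r = qform_matrix (pden r * e) (pden r * d) (pden r)
      (pnum r) (pden r) (pden r)" for r
    by (simp add: pencil16_def pencil_conic_qform_matrix)
  have "smooth_conic (pencil_conic (pencil16 d e) r) \<longleftrightarrow>
      pden r * ((pnum r - u * pden r) * (pnum r - v * pden r)) \<noteq> 0" for r
  proof -
    have "disc_form 0 \<kappa> (- \<kappa> * (u + v)) (\<kappa> * u * v) (pnum r) (pden r)
       = \<kappa> * (pden r * ((pnum r - u * pden r) * (pnum r - v * pden r)))"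
      by (simp add: disc_form_def algebra_simps power2_eq_square power3_eq_cube)
    then show ?thesis using smooth_pencil_conic[OF disc, of r] k by simp
  qed
  then have smooth: "smooth_conic (pencil_conic (pencil16 d e) r) \<longleftrightarrow> r \<in> ?S" for r
    by (cases r) auto
  have same: "same_conic (pencil_conic (pencil16 d e) r) (pencil_conic (pencil16 d e) s) \<longleftrightarrow> r = s" for r s
    unfolding pencil16_def
    by (rule same_conic_pencil[of _ 1 2 _ 3 3]) (use two in \<open>simp_all add: qform_matrix_def\<close>)
  have trans: "transversal_lines (pencil_conic (pencil16 d e) r) (pencil_conic (pencil16 d e) s)"
    if r: "r \<notin> ?S" and s: "s \<in> ?S" for r s
  proof -
    obtain x where x: "s = Some x" "x \<noteq> u" "x \<noteq> v" using s by auto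
    have "qform_disc e d 1 x 1 1 \<noteq> 0"
      using smooth[of s] s unfolding conic x smooth_conic_qform_matrix[OF two] by simp
    note I = transversal_linesI[OF two _ _ _ _ _ _ _ this]
    show ?thesis
    proof (cases r)
      case None
      have "4 * to_ac d \<noteq> 1" "4 * to_ac e \<noteq> 1"
        using d1 e1 by (metis right_minus_eq to_ac_1 to_ac_eq_iff to_ac_mult to_ac_numeral)+
      note ne = this
      show ?thesis
        unfolding conic x None pnum_simps pden_simps mult_zero_left mult_1_left
        by (rule I[where la = 1 and lb = 0 and lc = 0 and ma = 0 and mb = 1 and mc = 0])
           (use ne in \<open>simp_all add: dual_qform_def\<close>)
    next
      case (Some y)
      have y: "y = u \<or> y = v" using r Some by auto
      obtain a where a: "to_ac e = a * (1 - a)" and a2: "a \<noteq> 1 - a"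
        using conjugate_factors[OF two e1] .
      obtain b0 where b0: "to_ac d = b0 * (1 - b0)" using conjugate_factors[OF two d1] .
      \<comment> \<open>The parameter \<open>y\<close> is one of the two products of conjugate roots; in the second case
        \<open>b0\<close> has to be replaced by its conjugate \<open>1 - b0\<close>.\<close>
      have "\<exists>b. to_ac d = b * (1 - b) \<and> to_ac y = a * (1 - b) + b * (1 - a)"
      proof -
        have "y * y = y * (u + v) - u * v" using y by (auto simp: algebra_simps)
        then have "y * y = y - (d + e - 4 * d * e)" by (simp add: sum prod)
        then have "to_ac y * to_ac y = to_ac y - (to_ac d + to_ac e - 4 * to_ac d * to_ac e)"
          by (simp flip: to_ac_mult to_ac_diff to_ac_add to_ac_numeral)
        moreover have "(Y - (a * (1 - b0) + b0 * (1 - a))) * (Y - (a * b0 + (1 - b0) * (1 - a)))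
            = Y * Y - (Y - (b0 * (1 - b0) + a * (1 - a) - 4 * (b0 * (1 - b0)) * (a * (1 - a))))" for Y
          by (simp add: algebra_simps)
        ultimately have "(to_ac y - (a * (1 - b0) + b0 * (1 - a))) * (to_ac y - (a * b0 + (1 - b0) * (1 - a))) = 0"
          using a b0 by simp
        then have "to_ac y = a * (1 - b0) + b0 * (1 - a) \<or> to_ac y = a * (1 - (1 - b0)) + (1 - b0) * (1 - a)"
          by simp
        moreover have "to_ac d = (1 - b0) * (1 - (1 - b0))" using b0 by simp
        ultimately show ?thesis using b0 by blast
      qed
      then obtain b where b: "to_ac d = b * (1 - b)" "to_ac y = a * (1 - b) + b * (1 - a)" by blast
      \<comment> \<open>On the line, the conic with parameter \<open>t\<close> restricts to a multiple of \<open>x y\<close> by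
        \<open>t\<close> minus the parameter of the line pair; this explains the square.\<close>
      have dual: "dual_qform (a * (1 - a)) (b * (1 - b)) 1 t 1 1 a b 1
          = - ((t - (a * (1 - b) + b * (1 - a)))\<^sup>2)"
        for t a b :: "'a alg_closure"
        by (simp add: dual_qform_def algebra_simps power2_eq_square)
      have xy: "to_ac x - to_ac y \<noteq> 0" using x y by auto
      show ?thesis
        unfolding conic x Some pnum_simps pden_simps mult_1_left
      proof (rule I[where la = a and lb = b and lc = 1 and ma = "1 - a" and mb = "1 - b" and mc = 1])
        show "dual_qform (to_ac e) (to_ac d) (to_ac 1) (to_ac x) (to_ac 1) (to_ac 1) a b 1 \<noteq> 0"
          using xy unfolding a b(1) to_ac_1 dual by (simp add: b(2))
        have "dual_qform (to_ac e) (to_ac d) (to_ac 1) (to_ac x) (to_ac 1) (to_ac 1) (1 - a) (1 - b) 1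
           = - ((to_ac x - to_ac y)\<^sup>2)"
          using dual[of "1 - a" "1 - b" "to_ac x"] by (simp add: a b algebra_simps)
        then show "dual_qform (to_ac e) (to_ac d) (to_ac 1) (to_ac x) (to_ac 1) (to_ac 1) (1 - a) (1 - b) 1 \<noteq> 0"
          using xy by simp
      qed (use a b a2 in \<open>simp_all add: algebra_simps\<close>)
    qed
  qed
  have "smooth_pairs (pencil16 d e) = distinct_pairs ?S ?S" using smooth_pairs_eq[OF same smooth] .
  moreover have "valid_pairs (pencil16 d e) = distinct_pairs UNIV ?S"
    by (rule valid_pairs_eq[OF same smooth]) (use trans in auto)
  ultimately show ?thesis using that[OF uv k(2) disc] by blast
qed
lemma pencil16_prob:
  fixes d e w :: "'a::{field,finite}"
  assumes two: "(2::'a) \<noteq> 0" and w: "(1 - 4 * d) * (1 - 4 * e) = w\<^sup>2" "w \<noteq> 0"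
  defines "P \<equiv> pencil16 d e"
  shows "CARD('a) > 3 \<Longrightarrow> poncelet4_prob_is P (smooth_pairs P) (3 / (real CARD('a) - 2))"
    and "CARD('a) = 3 \<Longrightarrow> smooth_pairs P = {}"
    and "poncelet4_prob_is P (valid_pairs P) (3 / real CARD('a))"
proof -
  obtain u v \<kappa> :: 'a where uv: "u \<noteq> v" "\<kappa> \<noteq> 0"
    and disc: "has_disc P 0 \<kappa> (- \<kappa> * (u + v)) (\<kappa> * u * v)"
    and smooth: "smooth_pairs P = distinct_pairs (Some ` (- {u, v})) (Some ` (- {u, v}))"
    and valid: "valid_pairs P = distinct_pairs UNIV (Some ` (- {u, v}))"
    unfolding P_def using pencil16_pairs[OF two w] .
  show "CARD('a) > 3 \<Longrightarrow> poncelet4_prob_is P (smooth_pairs P) (3 / (real CARD('a) - 2))"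
    "poncelet4_prob_is P (valid_pairs P) (3 / real CARD('a))"
    unfolding smooth valid using poncelet4_prob_three_roots[OF two disc uv(2,1)] by simp_all
  assume "CARD('a) = 3"
  then have "card (Some ` (- {u, v}) :: 'a option set) = 1"
    using uv(1) by (simp add: card_image Compl_eq_Diff_UNIV card_Diff_subset)
  then have "card (smooth_pairs P) = 0" unfolding smooth by (simp add: card_distinct_pairs)
  then show "smooth_pairs P = {}" by simp
qed

theorem corollary3p24:
  fixes b c d e \<nu> \<rho> \<sigma> :: "'a::{field,finite}"
    and q :: real
  assumes "CHAR('a) \<noteq> 2"
    and "q = real CARD('a)"
    and "irreducible [:1, c, b, 1:]"
    and "irreducible [:d, 1, 1:]"
    and "irreducible [:e, 1, 1:]"
    and "\<not> is_square \<nu>"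
    and "\<not> is_square (\<rho>\<^sup>2 - 4 * \<nu> * \<sigma>\<^sup>2)"
  shows
    "(\<forall>P \<in> {pencil3, pencil16 d e}.
        (q > 3 \<longrightarrow> poncelet4_prob_is P (smooth_pairs P) (3 / (q - 2))) \<and>
        (q = 3 \<longrightarrow> smooth_pairs P = {}) \<and>
        poncelet4_prob_is P (valid_pairs P) (3 / q)) \<and>
     (\<forall>P \<in> {pencil4, pencil15 e}.
        poncelet4_prob_is P (smooth_pairs P) (1 / (q - 2)) \<and>
        poncelet4_prob_is P (valid_pairs P) (1 / (q - 1))) \<and>
     (\<forall>P \<in> {pencil5, pencil8 :: 'a pencil}.
        poncelet4_prob_is P (smooth_pairs P) 0 \<and>
        poncelet4_prob_is P (valid_pairs P) 0) \<and>
     (\<forall>P \<in> {pencil6, pencil17 e}.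
        poncelet4_prob_is P (smooth_pairs P) (1 / (q - 2)) \<and>
        poncelet4_prob_is P (valid_pairs P) (1 / (q - 2))) \<and>
     (\<forall>P \<in> {pencil14 e, pencil19 \<nu> \<rho> \<sigma>}.
        poncelet4_prob_is P (smooth_pairs P) (1 / q) \<and>
        poncelet4_prob_is P (valid_pairs P) (1 / q)) \<and>
     (poncelet4_prob_is (pencil18 b c) (smooth_pairs (pencil18 b c)) 0 \<and>
      poncelet4_prob_is (pencil18 b c) (valid_pairs (pencil18 b c)) 0)"
proof -
  have two: "(2::'a) \<noteq> 0" using assms(1) by (rule two_neq_zero_if_CHAR)
  have d: "\<not> is_square (1 - 4 * d)" and e: "\<not> is_square (1 - 4 * e)"
    using irreducible_imp_nonsquare_disc[OF two] assms(4,5) by blast+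
  have e1: "1 - 4 * e \<noteq> 0"
  proof
    assume "1 - 4 * e = 0"
    then show False using e by simp
  qed
  have e0: "e \<noteq> 0"
  proof
    assume "e = 0"
    then show False using e by simp
  qed
  obtain w where w: "(1 - 4 * d) * (1 - 4 * e) = w\<^sup>2"
    using is_square_mult_nonsquares[OF two d e] by (auto elim: is_nth_powerE)
  have w0: "w \<noteq> 0"
  proof
    assume "w = 0"
    then have "1 - 4 * d = 0 \<or> 1 - 4 * e = 0" using w by simp
    then show False using d e by auto
  qed
  have split: "(1 - 4 * 0) * (1 - 4 * 0) = (1::'a)\<^sup>2" by simp
  \<comment> \<open>For \<open>d = e = 0\<close> the product \<open>(1 - 4 d) (1 - 4 e)\<close> is a nonzero square as well.\<close>
  have pencil3: "pencil3 = pencil16 0 (0::'a)" by (simp add: pencil3_def pencil16_def)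
  have q: "q > 3 \<Longrightarrow> CARD('a) > 3" "q = 3 \<Longrightarrow> CARD('a) = 3" unfolding assms(2) by simp_all
  note pencil16 = pencil16_prob[OF two w w0, folded assms(2)]
  note pencil3 = pencil16_prob[OF two split one_neq_zero, folded pencil3 assms(2)]
  note pencil4 = pencil4_prob[OF two, folded assms(2)]
    and pencil15 = pencil15_prob[OF two e0 e1, folded assms(2)]
    and pencil5 = pencil5_prob[OF two] and pencil8 = pencil8_prob[OF two]
    and pencil6 = pencil6_prob[OF two, folded assms(2)]
    and pencil17 = pencil17_prob[OF two e1, folded assms(2)]
    and pencil14 = pencil14_prob[OF two e, folded assms(2)]
    and pencil19 = pencil19_prob[OF two assms(6,7), folded assms(2)]
    and pencil18 = pencil18_prob[OF two assms(3)]
  have ball_pair: "\<forall>P \<in> {P1, P2}. Q P" if "Q P1" "Q P2" for Q and P1 P2 :: "'a pencil"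
    using that by simp
  show ?thesis
    by (intro conjI impI ball_pair;
        (rule pencil16(1)[OF q(1)] pencil16(2)[OF q(2)] pencil16(3)
           pencil3(1)[OF q(1)] pencil3(2)[OF q(2)] pencil3(3)
           pencil4 pencil15 pencil5 pencil8 pencil6 pencil17 pencil14 pencil19 pencil18;
         assumption?))
qed

end
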